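(* Let $n\ge 2$ be an integer, let $\varepsilon$ be a positive real number and let ${\bf a}=(a_1,\ldots ,a_n)$ be an $n$-tuple of non-zero rational numbers. There exists a positive number $s_1$, which is effectively computable in terms of $\varepsilon$ and ${\bf a}$, with the property that for every integer $s\geq s_1$ there is a set of primes $S$ of cardinality $s$ such that $$g({\bf a},S)\geq \exp\big\{(4-\varepsilon )s^{1/2}(\log s)^{-1/2}\big\}.$$
   Context: For a set $S$ of (rational) prime numbers, an $S$-unit is a non-zero rational number (of either sign) such that both the denominator and the numerator of its simplified representation are composed of primes from $S$. The total degree of a polynomial $P$ is the maximum of the sums $k_1+\cdots +k_n$ taken over all monomials $X_1^{k_1}\cdots X_n^{k_n}$ occurring in $P$. For a set of primes $S$ and a tuple ${\bf a}=(a_1,\ldots ,a_n)$ of non-zero rational numbers, $g({\bf a},S)$ denotes the smallest integer $g$ with the following property: there exists a polynomial $P\in\mathbb{C}[X_1,\ldots ,X_n]$ of total degree $g$, not divisible by $a_1X_1+\cdots +a_nX_n-1$, such that $P(x_1,\ldots ,x_n)=0$ for every tuple $(x_1,\ldots ,x_n)$ of $S$-units with $a_1x_1+\cdots +a_nx_n=1$. *)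

theory Defs
  imports
    Complex_Main
    "HOL-Library.Poly_Mapping"
    "HOL-Library.Nat_Bijection"
    "HOL-Library.Extended_Nat"
    "HOL-Library.Extended_Real"
    "HOL-Computational_Algebra.Primes"
begin

definition S_unit :: "nat set \<Rightarrow> rat \<Rightarrow> bool" where
  "S_unit S x \<longleftrightarrow> x \<noteq> 0 \<and>
     (\<forall>p::nat. prime p \<longrightarrow>
        int p dvd fst (quotient_of x) \<or> int p dvd snd (quotient_of x) \<longrightarrow> p \<in> S)"

text \<open>Polynomials over the complex numbers in the variables \<open>X\<^sub>0, X\<^sub>1, \<dots>\<close>: a monomial is a
  finitely supported exponent function, a polynomial is a finitely supported coefficient
  function on monomials, and the ring structure is the convolution product of
  \<^theory>\<open>HOL-Library.Poly_Mapping\<close>.\<close>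

type_synonym cpoly = "(nat \<Rightarrow>\<^sub>0 nat) \<Rightarrow>\<^sub>0 complex"

definition polys_in :: "nat \<Rightarrow> cpoly set" where
  "polys_in n = {P. \<forall>m \<in> Poly_Mapping.keys P. Poly_Mapping.keys m \<subseteq> {..<n}}"

definition poly_eval :: "(nat \<Rightarrow> complex) \<Rightarrow> cpoly \<Rightarrow> complex" where
  "poly_eval x P =
     (\<Sum>m\<in>Poly_Mapping.keys P. Poly_Mapping.lookup P m *
        (\<Prod>i\<in>Poly_Mapping.keys m. x i ^ Poly_Mapping.lookup m i))"

text \<open>The inserted \<open>0\<close> only matters for the zero polynomial.\<close>

definition total_degree :: "cpoly \<Rightarrow> nat" where
  "total_degree P = Max (insert 0
     ((\<lambda>m. \<Sum>i\<in>Poly_Mapping.keys m. Poly_Mapping.lookup m i) `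
        Poly_Mapping.keys P))"

text \<open>The polynomial \<open>a\<^sub>0 X\<^sub>0 + \<dots> + a\<^bsub>n-1\<^esub> X\<^bsub>n-1\<^esub> - 1\<close>, where \<open>n\<close> is the length of \<open>a\<close>.\<close>

definition hyperplane_poly :: "rat list \<Rightarrow> cpoly" where
  "hyperplane_poly a =
     (\<Sum>i<length a. Poly_Mapping.single (Poly_Mapping.single i 1) (of_rat (a ! i))) - 1"

definition unit_solutions :: "rat list \<Rightarrow> nat set \<Rightarrow> rat list set" where
  "unit_solutions a S =
     {x. length x = length a \<and> (\<forall>i<length a. S_unit S (x ! i)) \<and>
         (\<Sum>i<length a. a ! i * x ! i) = 1}"

text \<open>Divisibility is taken inside the ring of polynomials in \<open>length a\<close> variables.\<close>

definition admissible :: "rat list \<Rightarrow> nat set \<Rightarrow> cpoly \<Rightarrow> bool" where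
  "admissible a S P \<longleftrightarrow>
     P \<in> polys_in (length a) \<and>
     \<not> (\<exists>Q \<in> polys_in (length a). P = hyperplane_poly a * Q) \<and>
     (\<forall>x \<in> unit_solutions a S. poly_eval (\<lambda>i. of_rat (x ! i)) P = 0)"

text \<open>The values are extended naturals so that the minimum over an empty set of degrees is
  \<open>\<infinity>\<close>, not \<open>0\<close>; whenever an admissible polynomial exists, this is the least degree.\<close>

definition min_vanishing_degree :: "rat list \<Rightarrow> nat set \<Rightarrow> enat" where
  "min_vanishing_degree a S = (INF P \<in> {P. admissible a S P}. enat (total_degree P))"

text \<open>Total recursive functions of a given arity: closure of the basic functions under
  composition, primitive recursion and minimisation of regular functions. Only the values on
  argument lists of length equal to the arity are meaningful.\<close>

inductive recursive :: "nat \<Rightarrow> (nat list \<Rightarrow> nat) \<Rightarrow> bool" where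
  zero: "recursive k (\<lambda>xs. 0)"
| succ: "recursive 1 (\<lambda>xs. Suc (hd xs))"
| proj: "i < k \<Longrightarrow> recursive k (\<lambda>xs. xs ! i)"
| comp: "recursive (length hs) f \<Longrightarrow> \<forall>h \<in> set hs. recursive k h \<Longrightarrow>
           recursive k (\<lambda>xs. f (map (\<lambda>h. h xs) hs))"
| prim_rec: "recursive k f \<Longrightarrow> recursive (Suc (Suc k)) h \<Longrightarrow>
           recursive (Suc k)
             (\<lambda>xs. rec_nat (f (tl xs)) (\<lambda>y r. h (y # r # tl xs)) (hd xs))"
| minim: "recursive (Suc k) f \<Longrightarrow> \<forall>xs. length xs = k \<longrightarrow> (\<exists>y. f (y # xs) = 0) \<Longrightarrow>
           recursive k (\<lambda>xs. LEAST y. f (y # xs) = 0)"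

definition rat_encode :: "rat \<Rightarrow> nat" where
  "rat_encode r =
     prod_encode (int_encode (fst (quotient_of r)), nat (snd (quotient_of r)))"

text \<open>Computability in terms of a real \<open>\<epsilon> > 0\<close> and a tuple \<open>a\<close>: an algorithm cannot read \<open>\<epsilon>\<close> as a
  finite datum, so the first argument is meant to be any rational \<open>\<delta>\<close> with \<open>0 < \<delta> \<le> \<epsilon>\<close>. If \<open>\<epsilon>\<close> is
  itself rational, \<open>\<delta> = \<epsilon>\<close> is allowed, and such a \<open>\<delta>\<close> can be found effectively from rational
  approximations to any real \<open>\<epsilon> > 0\<close>.\<close>

definition effectively_computable :: "(rat \<Rightarrow> rat list \<Rightarrow> nat) \<Rightarrow> bool" where
  "effectively_computable f \<longleftrightarrow>
     (\<exists>F. recursive 1 F \<and>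
        (\<forall>d a. f d a = F [prod_encode (rat_encode d, list_encode (map rat_encode a))]))"

end

theory Submission
  imports Defs
    "HOL-Analysis.Convex"
    "HOL-Computational_Algebra.Polynomial"
    "HOL-Real_Asymp.Real_Asymp"
begin

text \<open>
  The two-variable equation carries all the solutions, and these are found by the argument of
  Konyagin and Soundararajan. Take about \<open>s/8\<close> primes \<open>T\<^sub>1\<close> and as many further primes \<open>T\<^sub>2\<close>, all of
  size \<open>s\<close> up to a logarithm, let \<open>X\<close> be the set of products of \<open>w = \<lfloor>\<surd>s\<rfloor>\<close> primes of \<open>T\<^sub>1\<close> and \<open>M\<close>
  the set of products of \<open>w/3\<close> primes of \<open>T\<^sub>2\<close>. For each \<open>m \<in> M\<close>, many pairs \<open>a, b\<close> in \<open>X\<close> are congruent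
  modulo \<open>m\<close>, and some value \<open>k\<close> of \<open>(a - b)/m\<close> is so popular that \<open>a - b = k m\<close> has
  \<open>exp (c \<surd>s ln s)\<close> solutions. The bonus \<open>card M\<close> over the pigeonhole argument for
  \<open>a - b = k\<close> makes the constant \<open>4\<close> irrelevant, so that Chebyshev's lower bound replaces the prime
  number theorem. The number \<open>k\<close> has few prime factors; adjoin them, and those of the
  coefficients, to the set of primes.

  For \<open>n\<close> variables split the last summand repeatedly by \<open>1 = u + (1 - u)\<close>. If \<open>P\<close> has degree less
  than the number of available \<open>u\<close>, its pullback vanishes on a grid that is too large, one
  variable at a time, so it vanishes identically; hence \<open>P\<close> vanishes on the hyperplane and is divisible
  by its equation. The coefficients enter only through the number of primes dividing them, which
  their code bounds, so \<open>s\<^sub>1\<close> is affine in the code.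
\<close>

section \<open>Chebyshev's lower bound for the prime counting function\<close>

text \<open>The numbers \<open>m * (n choose m)\<close> are the reciprocals of the entries of the
  Leibniz harmonic triangle. Each entry is a difference of two entries of the previous column, so a
  common multiple of \<open>1, ..., n\<close>, which clears the first column, clears all of
  them.\<close>

lemma leibniz_triangle_dvd:
  fixes L :: nat
  assumes "\<And>i. 1 \<le> i \<Longrightarrow> i \<le> n \<Longrightarrow> i dvd L" "1 \<le> m" "m \<le> n"
  shows "m * (n choose m) dvd L"
  using assms
proof (induction m arbitrary: n)
  case 0
  then show ?case by simp
next
  case (Suc m)
  show ?case
  proof (cases "m = 0")
    case True
    then show ?thesis using Suc.prems by simp
  next
    case False
    then have m1: "1 \<le> m" and mn: "m < n" using Suc.prems by auto
    obtain n' where n': "n = Suc n'" using mn by (cases n) auto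
    have m_le: "m \<le> n'" using mn n' by simp
    define A where "A = m * (n choose m)"
    define B where "B = m * (n' choose m)"
    define C where "C = Suc m * (n choose Suc m)"
    have "A dvd L" unfolding A_def by (rule Suc.IH) (use Suc.prems m1 mn in auto)
    then obtain a where a: "L = A * a" by (elim dvdE)
    have "B dvd L" unfolding B_def by (rule Suc.IH) (use Suc.prems m1 mn n' in auto)
    then obtain b where b: "L = B * b" by (elim dvdE)
    have C1: "C = n * (n' choose m)" unfolding C_def n' by (rule Suc_times_binomial)
    have C2: "C = (n - m) * (n choose m)"
      unfolding C_def using binomial_absorb_comp[of n m] C1 n' C_def
      by (metis diff_Suc_1)
    have CB: "int m * int C = int n * int B" unfolding C1 B_def by simp
    have CA: "int m * int C = (int n - int m) * int A"
      using mn unfolding C2 A_def by simp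
    \<comment> \<open>The triangle identity \<open>1/C = 1/B - 1/A\<close>, cleared of denominators;
      the common factor \<open>m\<close> of \<open>CA\<close> and \<open>CB\<close> is cancelled
      afterwards.\<close>
    have "int m * int L = int m * (int C * (int b - int a))"
    proof -
      have "int m * (int C * (int b - int a)) = (int m * int C) * int b - (int m * int C) * int a"
        by (simp add: algebra_simps)
      also have "\<dots> = int n * (int B * int b) - (int n - int m) * (int A * int a)"
        using CA CB by (metis mult.assoc)
      also have "\<dots> = int n * int L - (int n - int m) * int L" using a b by (metis of_nat_mult)
      also have "\<dots> = int m * int L" by (simp add: algebra_simps)
      finally show ?thesis by (rule sym)
    qed
    then have "int C * (int b - int a) = int L" using m1 by auto
    then have "int C dvd int L" by (metis dvd_triv_left)
    then show ?thesis unfolding C_def by (simp only: int_dvd_int_iff)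
  qed
qed

text \<open>The multiplicity of a prime in an lcm is the maximum of the multiplicities, so a prime
  power dividing the lcm already divides one of the numbers.\<close>

lemma prime_power_dvd_Lcm_atMost:
  assumes "prime (p::nat)" "p ^ e dvd Lcm {1..n}" "n \<ge> 1"
  shows "p ^ e \<le> n"
proof -
  have "\<exists>i\<in>{1..n}. p ^ e dvd i"
    using assms(2,3)
  proof (induction n)
    case 0
    then show ?case by simp
  next
    case (Suc n)
    show ?case
    proof (cases "n = 0")
      case True
      then show ?thesis using Suc.prems by auto
    next
      case False
      have "{1..Suc n} = insert (Suc n) {1..n}" by auto
      then have "p ^ e dvd lcm (Suc n) (Lcm {1..n})" using Suc.prems by simp
      moreover have "lcm (Suc n) (Lcm {1..n}) \<noteq> 0" by (simp add: lcm_eq_0_iff Lcm_0_iff)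
      ultimately have "e \<le> multiplicity p (lcm (Suc n) (Lcm {1..n}))"
        using assms(1) by (intro multiplicity_geI) auto
      also have "\<dots> = max (multiplicity p (Suc n)) (multiplicity p (Lcm {1..n}))"
        by (rule multiplicity_lcm) (use assms(1) in \<open>auto simp: Lcm_0_iff\<close>)
      finally have "p ^ e dvd Suc n \<or> p ^ e dvd Lcm {1..n}"
        by (metis le_max_iff_disj multiplicity_dvd')
      then show ?thesis using Suc.IH False by fastforce
    qed
  qed
  then show ?thesis by (auto dest!: dvd_imp_le)
qed

text \<open>Every exact prime power in the lcm is at most \<open>n\<close>, and only primes up to
  \<open>n\<close> occur.\<close>

lemma Lcm_atMost_le_power_card_primes:
  assumes "n \<ge> 1"
  shows "Lcm {1..n} \<le> n ^ card {p. prime p \<and> p \<le> (n::nat)}"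
proof -
  define L where "L = Lcm {1..n}"
  have L0: "L \<noteq> 0" unfolding L_def by (auto simp: Lcm_0_iff)
  have le: "p ^ multiplicity p L \<le> n" if "prime p" for p
    using prime_power_dvd_Lcm_atMost[OF that _ assms] multiplicity_dvd[of p L] unfolding L_def by blast
  have sub: "prime_factors L \<subseteq> {p. prime p \<and> p \<le> n}"
  proof
    fix p assume p: "p \<in> prime_factors L"
    then have "prime p" "p ^ 1 dvd L" by (auto simp: in_prime_factors_iff)
    then show "p \<in> {p. prime p \<and> p \<le> n}"
      using prime_power_dvd_Lcm_atMost[of p 1 n] assms unfolding L_def by auto
  qed
  have fin: "finite {p. prime p \<and> p \<le> n}" by simp
  have "L = (\<Prod>p\<in>prime_factors L. p ^ multiplicity p L)"
    using L0 by (simp add: prime_factorization_nat)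
  also have "\<dots> \<le> (\<Prod>p\<in>prime_factors L. n)"
    by (intro prod_mono) (auto intro!: le)
  also have "\<dots> = n ^ card (prime_factors L)" by simp
  also have "\<dots> \<le> n ^ card {p. prime p \<and> p \<le> n}"
    using card_mono[OF fin sub] assms by (intro power_increasing) auto
  finally show ?thesis unfolding L_def .
qed

text \<open>Nair's argument: \<open>n * ((2 * n) choose n)\<close> divides the lcm of
  \<open>1, ..., 2 * n\<close>, and the central binomial coefficient is at least
  \<open>4 ^ n / (2 * n)\<close>.\<close>

lemma chebyshev_lower:
  assumes "n \<ge> 1"
  shows "2 ^ (2 * n - 1) \<le> (2 * n) ^ card {p. prime p \<and> p \<le> 2 * n}"
proof -
  have "n * ((2 * n) choose n) dvd Lcm {1..2 * n}"
    by (rule leibniz_triangle_dvd) (use assms in auto)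
  then have "n * ((2 * n) choose n) \<le> Lcm {1..2 * n}"
    by (intro dvd_imp_le) (auto simp: Lcm_0_iff intro!: Nat.gr0I)
  also have "\<dots> \<le> (2 * n) ^ card {p. prime p \<and> p \<le> 2 * n}"
    by (rule Lcm_atMost_le_power_card_primes) (use assms in auto)
  finally have 1: "n * ((2 * n) choose n) \<le> (2 * n) ^ card {p. prime p \<and> p \<le> 2 * n}" .
  have "4 ^ n / (2 * real n) \<le> real ((2 * n) choose n)"
    using central_binomial_lower_bound[of n] assms by simp
  then have "4 ^ n \<le> 2 * (real n * real ((2 * n) choose n))"
    using assms by (simp add: field_simps)
  then have "real (4 ^ n) \<le> real (2 * (n * ((2 * n) choose n)))" by simp
  then have "4 ^ n \<le> 2 * (n * ((2 * n) choose n))" by (simp only: of_nat_le_iff)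
  moreover have "(4::nat) ^ n = 2 * 2 ^ (2 * n - 1)"
    using assms by (cases n) (auto simp: power_mult power_add)
  ultimately have "(2::nat) ^ (2 * n - 1) \<le> n * ((2 * n) choose n)" by linarith
  with 1 show ?thesis by linarith
qed

section \<open>Unit equations in two unknowns\<close>

lemma card_sq_le_card_congruent_pairs:
  fixes X :: "nat set"
  assumes "finite X" "m \<ge> 1"
  shows "card X ^ 2 \<le> m * card {(a, b) \<in> X \<times> X. a mod m = b mod m}"
proof -
  define c where "c = (\<lambda>r. {x \<in> X. x mod m = r})"
  have fin: "finite (c r)" for r using assms by (simp add: c_def)
  have "X = (\<Union>r\<in>{..<m}. c r)" using assms by (auto simp: c_def)
  then have "card X = card (\<Union>r\<in>{..<m}. c r)" by simp
  also have "\<dots> = (\<Sum>r<m. card (c r))"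
    by (intro card_UN_disjoint) (auto simp: fin, auto simp: c_def)
  finally have 1: "card X = (\<Sum>r<m. card (c r))" .
  have "{(a, b) \<in> X \<times> X. a mod m = b mod m} = (\<Union>r\<in>{..<m}. c r \<times> c r)"
    using assms by (auto simp: c_def)
  then have "card {(a, b) \<in> X \<times> X. a mod m = b mod m} = card (\<Union>r\<in>{..<m}. c r \<times> c r)" by simp
  also have "\<dots> = (\<Sum>r<m. card (c r \<times> c r))"
    by (intro card_UN_disjoint) (auto simp: fin, auto simp: c_def)
  finally have 2: "card {(a, b) \<in> X \<times> X. a mod m = b mod m} = (\<Sum>r<m. card (c r) ^ 2)"
    by (simp add: card_cartesian_product power2_eq_square)
  \<comment> \<open>Cauchy-Schwarz over the \<open>m\<close> residue classes.\<close>
  have "(\<Sum>r<m. real (card (c r)))\<^sup>2 \<le> (\<Sum>r<m. (real (card (c r)))\<^sup>2) * card {..<m}"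
    by (rule sum_squared_le_sum_of_squares)
  then have "real (card X ^ 2) \<le> real (m * card {(a, b) \<in> X \<times> X. a mod m = b mod m})"
    unfolding 1 2 by (simp add: mult.commute)
  then show ?thesis by (simp only: of_nat_le_iff)
qed

lemma card_sq_le_card_congruent_pairs_less:
  fixes X :: "nat set"
  assumes "finite X" "m \<ge> 1" "2 * m \<le> card X"
  shows "card X ^ 2 \<le> 4 * m * card {(a, b) \<in> X \<times> X. b < a \<and> m dvd a - b}"
proof -
  define D where "D = {(a, b) \<in> X \<times> X. a mod m = b mod m}"
  define L where "L = {(a, b) \<in> X \<times> X. b < a \<and> m dvd a - b}"
  have finL: "finite L" unfolding L_def
    by (rule finite_subset[of _ "X \<times> X"]) (use assms in auto)
  \<comment> \<open>A congruent pair is decreasing, increasing or diagonal. The diagonal costs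
    \<open>m * card X\<close> in the end, which \<open>2 * m \<le> card X\<close> makes at most half
    of \<open>card X ^ 2\<close>.\<close>
  have "D \<subseteq> L \<union> prod.swap ` L \<union> (\<lambda>x. (x, x)) ` X"
  proof (safe)
    fix a b assume "(a, b) \<in> D" and n1: "(a, b) \<notin> (\<lambda>x. (x, x)) ` X" and n2: "(a, b) \<notin> prod.swap ` L"
    then have ab: "a \<in> X" "b \<in> X" "a mod m = b mod m" by (auto simp: D_def)
    have "a \<noteq> b" using n1 ab by auto
    moreover have "\<not> a < b"
    proof
      assume "a < b"
      then have "(b, a) \<in> L" using ab unfolding L_def
        by (auto simp: mod_eq_dvd_iff_nat[symmetric])
      then show False using n2 by force
    qed
    ultimately have "b < a" by simp
    then show "(a, b) \<in> L" using ab unfolding L_def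
      by (auto simp: mod_eq_dvd_iff_nat[symmetric])
  qed
  then have "card D \<le> card (L \<union> prod.swap ` L \<union> (\<lambda>x. (x, x)) ` X)"
    using finL assms by (intro card_mono) auto
  also have "\<dots> \<le> card L + card (prod.swap ` L) + card ((\<lambda>x. (x, x)) ` X)"
    by (meson card_Un_le add_le_mono1 le_trans)
  also have "\<dots> \<le> card L + card L + card X"
    using finL assms by (intro add_mono card_image_le) auto
  finally have "m * card D \<le> m * (2 * card L + card X)" by simp
  moreover have "card X ^ 2 \<le> m * card D"
    unfolding D_def by (rule card_sq_le_card_congruent_pairs) fact+
  ultimately have "2 * card X ^ 2 \<le> 4 * m * card L + 2 * m * card X" by (simp add: algebra_simps)
  moreover have "2 * m * card X \<le> card X ^ 2"
    using assms by (simp add: power2_eq_square)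
  ultimately show ?thesis unfolding L_def by linarith
qed

text \<open>Count the triples \<open>(m, a, b)\<close> with \<open>b < a\<close> and
  \<open>m\<close> dividing \<open>a - b\<close>. Each \<open>m\<close> contributes at least
  \<open>card X ^ 2 / (4 * hi)\<close> of them, while the quotient \<open>(a - b) / m\<close> takes
  at most \<open>N div lo\<close> values; \<open>k\<close> is the most frequent one.\<close>

lemma popular_quotient:
  fixes X M :: "nat set"
  assumes X: "X \<subseteq> {1..N}" and M: "\<And>m. m \<in> M \<Longrightarrow> lo \<le> m \<and> m \<le> hi"
    and lo: "lo \<ge> 1" and hi: "2 * hi \<le> card X" and N: "N \<ge> 1"
  shows "\<exists>k\<in>{1..N}. card X ^ 2 * card M * lo \<le>
    4 * hi * N * card {(a, m) \<in> X \<times> M. k * m < a \<and> a - k * m \<in> X}"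
proof -
  have finX: "finite X" using X finite_subset by blast
  have finM: "finite M" by (rule finite_subset[of _ "{lo..hi}"]) (use M in auto)
  define P where "P = (\<lambda>m. {(a, b) \<in> X \<times> X. b < a \<and> m dvd a - b})"
  define T where "T = (SIGMA m:M. P m)"
  define K where "K = N div lo"
  define q where "q = (\<lambda>(m, a, b). (a - b) div (m::nat))"
  define F where "F = (\<lambda>k. {(a, m) \<in> X \<times> M. k * m < a \<and> a - k * m \<in> X})"
  have finP: "finite (P m)" for m
    unfolding P_def by (rule finite_subset[of _ "X \<times> X"]) (use finX in auto)
  have finF: "finite (F k)" for k
    unfolding F_def by (rule finite_subset[of _ "X \<times> M"]) (use finX finM in auto)
  have finT: "finite T" unfolding T_def using finM finP by auto
  have "card X ^ 2 \<le> 4 * hi * card (P m)" if "m \<in> M" for m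
  proof -
    have "card X ^ 2 \<le> 4 * m * card (P m)" unfolding P_def
      by (rule card_sq_le_card_congruent_pairs_less) (use M[OF that] lo hi finX in auto)
    also have "\<dots> \<le> 4 * hi * card (P m)" using M[OF that] by simp
    finally show ?thesis .
  qed
  then have "(\<Sum>m\<in>M. card X ^ 2) \<le> (\<Sum>m\<in>M. 4 * hi * card (P m))" by (rule sum_mono)
  also have "\<dots> = 4 * hi * card T" unfolding T_def
    using finM finP by (simp add: sum_distrib_left)
  finally have 1: "card X ^ 2 * card M \<le> 4 * hi * card T" by (simp add: mult.commute)
  have qT: "q ` T \<subseteq> {1..K}"
  proof
    fix z assume "z \<in> q ` T"
    then obtain m a b where t: "m \<in> M" "a \<in> X" "b < a" "m dvd a - b" "z = (a - b) div m"
      unfolding T_def P_def q_def by auto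
    have m: "lo \<le> m" using M t by auto
    have "m \<le> a - b" using t by (intro dvd_imp_le) auto
    then have "z \<ge> 1" unfolding t using m lo by (simp add: div_greater_zero_iff Suc_le_eq)
    moreover have "z \<le> K"
    proof -
      have "a - b \<le> N" using t X by force
      then have "z \<le> N div m" unfolding t by (rule div_le_mono)
      also have "\<dots> \<le> N div lo" using m lo by (intro div_le_mono2) auto
      finally show ?thesis by (simp add: K_def)
    qed
    ultimately show "z \<in> {1..K}" by simp
  qed
  \<comment> \<open>Once the quotient \<open>k\<close> is fixed, \<open>(a, m)\<close> determines
    \<open>b = a - k * m\<close>.\<close>
  have fib: "card {t \<in> T. q t = k} \<le> card (F k)" for k
  proof (rule card_inj_on_le[of "\<lambda>(m, a, b). (a, m)"])
    have rep: "a = k * m + b \<and> m \<in> M \<and> k * m + b \<in> X \<and> b \<in> X \<and> 0 < b" if "(m, a, b) \<in> T" "q (m, a, b) = k" for m a b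
      using that X unfolding T_def P_def q_def by force
    show "inj_on (\<lambda>(m, a, b). (a, m)) {t \<in> T. q t = k}"
      by (rule inj_onI) (auto dest!: rep)
    show "(\<lambda>(m, a, b). (a, m)) ` {t \<in> T. q t = k} \<subseteq> F k"
    proof (clarify)
      fix m a b assume "(m, a, b) \<in> T" "k = q (m, a, b)"
      from rep[OF this(1) this(2)[symmetric]] show "(a, m) \<in> F (q (m, a, b))"
        unfolding F_def \<open>k = q (m, a, b)\<close>[symmetric] by clarsimp
    qed
  qed (rule finF)
  show ?thesis
  proof (cases "card X ^ 2 * card M = 0")
    case True
    have "card X ^ 2 * card M * lo = 0" unfolding True by simp
    \<comment> \<open>Here \<open>K\<close> may be \<open>0\<close>, so there may be no most
      frequent quotient; the left side is \<open>0\<close> and \<open>k = 1\<close> serves.\<close>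
    then show ?thesis using N by (intro bexI[of _ 1]) auto
  next
    case False
    then have "T \<noteq> {}" using 1 by auto
    then have K0: "{1..K} \<noteq> {}" using qT by blast
    obtain k where k: "k \<in> {1..K}" and max: "\<And>j. j \<in> {1..K} \<Longrightarrow> card (F j) \<le> card (F k)"
    proof -
      have "Max ((\<lambda>j. card (F j)) ` {1..K}) \<in> (\<lambda>j. card (F j)) ` {1..K}"
        using K0 by (intro Max_in) auto
      then obtain k where "k \<in> {1..K}" "card (F k) = Max ((\<lambda>j. card (F j)) ` {1..K})" by auto
      then show ?thesis by (intro that[of k]) auto
    qed
    have "T = (\<Union>j\<in>{1..K}. {t \<in> T. q t = j})" using qT by auto
    then have "card T = card (\<Union>j\<in>{1..K}. {t \<in> T. q t = j})" by simp
    also have "\<dots> \<le> (\<Sum>j\<in>{1..K}. card {t \<in> T. q t = j})" by (rule card_UN_le) simp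
    also have "\<dots> \<le> (\<Sum>j\<in>{1..K}. card (F k))"
      by (rule sum_mono) (use fib max le_trans in blast)
    also have "\<dots> = K * card (F k)" by simp
    finally have 2: "card T \<le> K * card (F k)" .
    have "card X ^ 2 * card M * lo \<le> 4 * hi * (K * card (F k)) * lo"
      using 1 2 by (meson le_trans mult_le_mono1 mult_le_mono2)
    also have "\<dots> = 4 * hi * (K * lo) * card (F k)" by simp
    also have "\<dots> \<le> 4 * hi * N * card (F k)"
      by (intro mult_right_mono mult_left_mono) (auto simp: K_def)
    finally have "card X ^ 2 * card M * lo \<le> 4 * hi * N * card (F k)" .
    moreover have "k \<in> {1..N}" using k by (auto simp: K_def intro: le_trans[OF _ div_le_dividend])
    ultimately show ?thesis unfolding F_def by blast
  qed
qed

section \<open>Arithmetic of S-units\<close>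

lemma S_unit_iff:
  "S_unit S x \<longleftrightarrow> (\<exists>p q. p \<noteq> 0 \<and> q \<noteq> 0 \<and> x = of_int p / of_int q \<and>
     (\<forall>l. prime l \<longrightarrow> int l dvd p * q \<longrightarrow> l \<in> S))" (is "_ \<longleftrightarrow> ?R")
proof
  assume S: "S_unit S x"
  obtain p q where pq: "quotient_of x = (p, q)" by force
  have x: "x = of_int p / of_int q" using quotient_of_div[OF pq] .
  have "q > 0" using quotient_of_denom_pos[OF pq] .
  moreover have "p \<noteq> 0" using S x unfolding S_unit_def by auto
  moreover have "l \<in> S" if "prime l" "int l dvd p * q" for l
  proof -
    have "prime (int l)" using that by simp
    then have "int l dvd p \<or> int l dvd q" using that(2) prime_dvd_multD by blast
    then show ?thesis using S that(1) pq unfolding S_unit_def by auto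
  qed
  ultimately show ?R using x by (intro exI[of _ p] exI[of _ q]) auto
next
  assume ?R
  then obtain p q where pq: "p \<noteq> 0" "q \<noteq> 0" "x = of_int p / of_int q"
    and l: "\<And>l. prime l \<Longrightarrow> int l dvd p * q \<Longrightarrow> l \<in> S" by blast
  obtain p' q' where pq': "quotient_of x = (p', q')" by force
  have x: "x = of_int p' / of_int q'" using quotient_of_div[OF pq'] .
  have q': "q' > 0" using quotient_of_denom_pos[OF pq'] .
  have cop: "coprime p' q'" using quotient_of_coprime[OF pq'] .
  have "of_int (p' * q) = (of_int (p * q') :: rat)"
    using pq q' x by (simp add: field_simps)
  then have eq: "p' * q = p * q'" by (simp only: of_int_eq_iff)
  \<comment> \<open>The reduced numerator and denominator divide those of any other representation,
    so products and inverses can be handled without reducing fractions.\<close>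
  have "p' dvd p * q'" using eq by (metis dvd_triv_left)
  then have 1: "p' dvd p" using cop by (simp add: coprime_dvd_mult_left_iff)
  have "q' dvd p' * q" using eq by (metis dvd_triv_right)
  then have 2: "q' dvd q" using cop by (simp add: coprime_dvd_mult_right_iff coprime_commute)
  have "x \<noteq> 0" using pq by simp
  then show "S_unit S x" unfolding S_unit_def
    using l 1 2 pq' by (auto intro: dvd_trans dvd_mult2 dvd_mult)
qed

lemma S_unit_of_int:
  assumes "k \<noteq> 0" "\<And>l. prime l \<Longrightarrow> int l dvd k \<Longrightarrow> l \<in> S"
  shows "S_unit S (of_int k)"
  unfolding S_unit_iff using assms by (intro exI[of _ k] exI[of _ 1]) auto

lemma S_unit_mult:
  assumes "S_unit S x" "S_unit S y"
  shows "S_unit S (x * y)"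
proof -
  obtain p q where 1: "p \<noteq> 0" "q \<noteq> 0" "x = of_int p / of_int q"
    "\<And>l. prime l \<Longrightarrow> int l dvd p * q \<Longrightarrow> l \<in> S" using assms(1) unfolding S_unit_iff by blast
  obtain p' q' where 2: "p' \<noteq> 0" "q' \<noteq> 0" "y = of_int p' / of_int q'"
    "\<And>l. prime l \<Longrightarrow> int l dvd p' * q' \<Longrightarrow> l \<in> S" using assms(2) unfolding S_unit_iff by blast
  have "l \<in> S" if "prime l" "int l dvd (p * p') * (q * q')" for l
  proof -
    have "prime (int l)" using that by simp
    moreover have "int l dvd (p * q) * (p' * q')" using that(2) by (simp add: mult_ac)
    ultimately have "int l dvd p * q \<or> int l dvd p' * q'" using prime_dvd_multD by blast
    then show ?thesis using 1(4) 2(4) that by blast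
  qed
  then show ?thesis unfolding S_unit_iff using 1(1-3) 2(1-3)
    by (intro exI[of _ "p * p'"] exI[of _ "q * q'"]) auto
qed

lemma S_unit_inverse:
  assumes "S_unit S x"
  shows "S_unit S (inverse x)"
proof -
  obtain p q where 1: "p \<noteq> 0" "q \<noteq> 0" "x = of_int p / of_int q"
    "\<And>l. prime l \<Longrightarrow> int l dvd p * q \<Longrightarrow> l \<in> S" using assms(1) unfolding S_unit_iff by blast
  then show ?thesis unfolding S_unit_iff
    by (intro exI[of _ q] exI[of _ p]) (auto simp: mult.commute)
qed

lemma S_unit_divide: "S_unit S x \<Longrightarrow> S_unit S y \<Longrightarrow> S_unit S (x / y)"
  by (simp add: divide_inverse S_unit_mult S_unit_inverse)

lemma S_unit_prod: "(\<And>i. i \<in> I \<Longrightarrow> S_unit S (f i)) \<Longrightarrow> S_unit S (prod f I)"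
proof (induction I rule: infinite_finite_induct)
  case (insert i I)
  then show ?case by (simp add: S_unit_mult)
qed (use S_unit_of_int[of 1 S] in auto)

section \<open>Products of distinct primes and the number of prime factors\<close>

lemma prime_factors_prod_primes:
  fixes A :: "nat set"
  assumes "finite A" "\<And>p. p \<in> A \<Longrightarrow> prime p"
  shows "prime_factors (\<Prod>A) = A"
proof -
  have "prime_factors (prod (\<lambda>x. x) A) = \<Union> ((prime_factors \<circ> (\<lambda>x. x)) ` A)"
    by (rule prime_factors_prod) (use assms in \<open>force dest: prime_gt_0_nat\<close>)+
  also have "\<dots> = A" using assms by (auto simp: prime_prime_factors)
  finally show ?thesis by simp
qed

definition prime_products :: "nat set \<Rightarrow> nat \<Rightarrow> nat set" where
  "prime_products T u = \<Prod> ` {A. A \<subseteq> T \<and> card A = u}"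

lemma card_prime_products:
  assumes "finite T" "\<And>p. p \<in> T \<Longrightarrow> prime p"
  shows "card (prime_products T u) = card T choose u"
proof -
  have "inj_on \<Prod> {A. A \<subseteq> T \<and> card A = u}"
  proof (rule inj_onI)
    fix A B assume "A \<in> {A. A \<subseteq> T \<and> card A = u}" "B \<in> {A. A \<subseteq> T \<and> card A = u}" "\<Prod>A = \<Prod>B"
    then show "A = B"
      using prime_factors_prod_primes[of A] prime_factors_prod_primes[of B] assms
      by (metis (mono_tags, lifting) finite_subset mem_Collect_eq subsetD)
  qed
  then show ?thesis unfolding prime_products_def
    by (simp add: card_image n_subsets assms)
qed

lemma prime_products_bounds:
  assumes "finite T" "\<And>p. p \<in> T \<Longrightarrow> lo \<le> p \<and> p \<le> hi" "x \<in> prime_products T u"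
  shows "lo ^ u \<le> x \<and> x \<le> hi ^ u"
proof -
  obtain A where A: "A \<subseteq> T" "card A = u" "x = \<Prod>A"
    using assms(3) unfolding prime_products_def by auto
  have "lo \<le> p \<and> p \<le> hi" if "p \<in> A" for p using that A(1) assms(2) by blast
  then have "(\<Prod>p\<in>A. lo) \<le> \<Prod>A" "\<Prod>A \<le> (\<Prod>p\<in>A. hi)"
    by (intro prod_mono; simp)+
  then show ?thesis using A by simp
qed

lemma prime_dvd_prime_products:
  assumes "finite T" "\<And>p. p \<in> T \<Longrightarrow> prime p" "x \<in> prime_products T u" "prime p" "p dvd x"
  shows "p \<in> T"
proof -
  obtain A where A: "A \<subseteq> T" "card A = u" "x = \<Prod>A"
    using assms(3) unfolding prime_products_def by auto
  have fin: "finite A" using A assms finite_subset by auto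
  have primes: "prime q" if "q \<in> A" for q using that A(1) assms(2) by blast
  then have "0 \<notin> A" using not_prime_0 by blast
  then have "x \<noteq> 0" using fin A(3) by simp
  then have "p \<in> prime_factors x" using assms(4,5) by (simp add: in_prime_factors_iff)
  moreover have "prime_factors x = A" unfolding A(3) by (rule prime_factors_prod_primes[OF fin primes])
  ultimately show ?thesis using A(1) by blast
qed

text \<open>Bounds how many primes the popular value \<open>k\<close> adds to the set of primes;
  each prime factor contributes a factor of at least \<open>2\<close>.\<close>

lemma two_power_card_prime_factors_le:
  assumes "k \<ge> (1::nat)"
  shows "2 ^ card (prime_factors k) \<le> k"
proof -
  have "(\<Prod>p\<in>prime_factors k. 2) \<le> (\<Prod>p\<in>prime_factors k. p ^ multiplicity p k)"
  proof (rule prod_mono, safe)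
    fix p assume p: "p \<in> prime_factors k"
    then have "multiplicity p k \<noteq> 0" "2 \<le> p"
      using assms by (auto simp: prime_factors_multiplicity prime_ge_2_nat)
    then show "2 \<le> p ^ multiplicity p k" using self_le_power[of p "multiplicity p k"] by simp
  qed
  also have "\<dots> = k" using assms by (subst prime_factorization_nat[of k, symmetric]) auto
  finally show ?thesis by simp
qed

text \<open>With \<open>b = a - k * m\<close>, division by \<open>k * m\<close> gives
  \<open>x = a / (k * m)\<close> and \<open>1 - x = - b / (k * m)\<close>, both composed of primes
  from \<open>T1\<close>, \<open>T2\<close> and \<open>k\<close>. The hypothesis
  \<open>large\<close> says that the moduli are small enough for \<open>popular_quotient\<close>.
  The set \<open>S\<close> is quantified after \<open>k\<close> because it can be assembled only
  once \<open>k\<close> is known.\<close>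

lemma unit_solutions_from_two_prime_sets:
  fixes T1 T2 :: "nat set"
  assumes fin: "finite T1" "finite T2" and disj: "T1 \<inter> T2 = {}"
    and primes: "\<And>p. p \<in> T1 \<union> T2 \<Longrightarrow> prime p \<and> p \<le> y" and lo: "\<And>p. p \<in> T2 \<Longrightarrow> lo \<le> p"
    and card: "card T1 = t" "card T2 = t" and "lo \<ge> 1" "y \<ge> 1"
    and large: "2 * y ^ v \<le> t choose u"
  shows "\<exists>k\<in>{1..y ^ u}. \<forall>S. T1 \<union> T2 \<union> prime_factors k \<subseteq> S \<longrightarrow>
    (\<exists>U. finite U \<and> (\<forall>x\<in>U. S_unit S x \<and> S_unit S (1 - x)) \<and>
      (t choose u) ^ 2 * (t choose v) * lo ^ v \<le> 4 * y ^ v * y ^ u * card U)"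
proof -
  define X where "X = prime_products T1 u"
  define M where "M = prime_products T2 v"
  have X1: "x \<ge> 1 \<and> x \<le> y ^ u" if "x \<in> X" for x
  proof -
    have "1 ^ u \<le> x \<and> x \<le> y ^ u"
      by (rule prime_products_bounds[of T1 1 y x u])
        (use that primes fin prime_ge_1_nat in \<open>auto simp: X_def\<close>)
    then show ?thesis by simp
  qed
  have MB: "lo ^ v \<le> m \<and> m \<le> y ^ v" if "m \<in> M" for m
    using prime_products_bounds[of T2 lo y m v] that primes lo fin unfolding M_def by auto
  have cX: "card X = t choose u"
    unfolding X_def using card_prime_products[of T1 u] primes fin card by auto
  have cM: "card M = t choose v"
    unfolding M_def using card_prime_products[of T2 v] primes fin card by auto
  have "\<exists>k\<in>{1..y ^ u}. card X ^ 2 * card M * lo ^ v \<le>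
      4 * y ^ v * y ^ u * card {(a, m) \<in> X \<times> M. k * m < a \<and> a - k * m \<in> X}"
    by (rule popular_quotient) (use X1 MB large cX assms in \<open>auto simp: Suc_le_eq\<close>)
  then obtain k where k: "k \<in> {1..y ^ u}"
    and le: "card X ^ 2 * card M * lo ^ v \<le>
      4 * y ^ v * y ^ u * card {(a, m) \<in> X \<times> M. k * m < a \<and> a - k * m \<in> X}" by blast
  define F where "F = {(a, m) \<in> X \<times> M. k * m < a \<and> a - k * m \<in> X}"
  have finX: "finite X" unfolding X_def prime_products_def using fin by simp
  have finM: "finite M" unfolding M_def prime_products_def using fin by simp
  have finF: "finite F" unfolding F_def
    by (rule finite_subset[of _ "X \<times> M"]) (use finX finM in auto)
  define f where "f = (\<lambda>(a, m). of_int (int a) / (of_int (int k) * of_int (int m)) :: rat)"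
  have k0: "k > 0" using k by auto
  have m0: "m > 0" if "m \<in> M" for m
    using MB[OF that] \<open>lo \<ge> 1\<close> by (metis less_le_trans one_le_power zero_less_one)
  \<comment> \<open>Coprimality comes from the disjointness of \<open>T1\<close> and
    \<open>T2\<close>; it makes \<open>a / (k * m)\<close> determine both \<open>a\<close> and
    \<open>m\<close>, so that \<open>f\<close> is injective.\<close>
  have cop: "coprime a m" if "a \<in> X" "m \<in> M" for a m
  proof (rule ccontr)
    assume "\<not> coprime a m"
    then have "gcd a m \<noteq> 1" by (simp add: coprime_iff_gcd_eq_1)
    then obtain p where p: "prime p" "p dvd gcd a m" using prime_factor_nat by blast
    have "p \<in> T1" using prime_dvd_prime_products[of T1 a u p] p that primes fin unfolding X_def by auto
    moreover have "p \<in> T2" using prime_dvd_prime_products[of T2 m v p] p that primes fin unfolding M_def by auto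
    ultimately show False using disj by auto
  qed
  have "inj_on f F"
  proof (rule inj_onI, safe)
    fix a m a' m' assume 1: "(a, m) \<in> F" "(a', m') \<in> F" and eq: "f (a, m) = f (a', m')"
    then have am: "a \<in> X" "a' \<in> X" "m \<in> M" "m' \<in> M" by (auto simp: F_def)
    have "of_nat (a * m') = (of_nat (a' * m) :: rat)"
      using eq k0 m0[OF am(3)] m0[OF am(4)] unfolding f_def by (simp add: field_simps)
    then have eq': "a * m' = a' * m" by (simp only: of_nat_eq_iff)
    have "a dvd a'" using eq' cop[OF am(1,3)] by (metis coprime_dvd_mult_left_iff dvd_triv_left)
    moreover have "a' dvd a" using eq' cop[OF am(2,4)] by (metis coprime_dvd_mult_left_iff dvd_triv_left)
    ultimately show "a = a'" by (rule dvd_antisym)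
    then show "m = m'" using eq' X1[OF am(1)] by simp
  qed
  then have cF: "card (f ` F) = card F" by (rule card_image)
  show ?thesis
  proof (intro bexI[OF _ k] allI impI exI[of _ "f ` F"] conjI ballI)
    show "finite (f ` F)" using finF by simp
    show "(t choose u) ^ 2 * (t choose v) * lo ^ v \<le> 4 * y ^ v * y ^ u * card (f ` F)"
      using le unfolding cF unfolding F_def cX cM .
    fix S x assume S: "T1 \<union> T2 \<union> prime_factors k \<subseteq> S" and "x \<in> f ` F"
    then obtain a m where am: "a \<in> X" "m \<in> M" "k * m < a" "a - k * m \<in> X" and x: "x = f (a, m)"
      by (auto simp: F_def)
    have uX: "S_unit S (of_int (int b))" if "b \<in> X" for b
      by (rule S_unit_of_int)
        (use X1[OF that] prime_dvd_prime_products[of T1 b u] that primes fin S in \<open>auto simp: X_def\<close>)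
    have um: "S_unit S (of_int (int m))"
      by (rule S_unit_of_int)
        (use m0[OF am(2)] prime_dvd_prime_products[of T2 m v] am primes fin S in \<open>auto simp: M_def\<close>)
    have uk: "S_unit S (of_int (int k))"
      by (rule S_unit_of_int) (use k0 S in \<open>auto simp: in_prime_factors_iff\<close>)
    show "S_unit S x" unfolding x f_def prod.case
      by (intro S_unit_divide S_unit_mult uX um uk am)
    \<comment> \<open>The sign is split off as the factor \<open>-1\<close>, an S-unit since no
      prime divides it.\<close>
    have "1 - x = of_int (int (a - k * m)) / ((of_int (- 1) * of_int (int k)) * of_int (int m))"
      unfolding x f_def prod.case using am(3) k0 m0[OF am(2)] by (simp add: field_simps)
    also have "S_unit S \<dots>"
      by (intro S_unit_divide S_unit_mult uX um uk am S_unit_of_int) (auto simp: prime_nat_iff)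
    finally show "S_unit S (1 - x)" .
  qed
qed

text \<open>\<open>L\<close> bounds the logarithm of the largest prime in \<open>T1\<close> and
  \<open>T2\<close>; \<open>\<beta>\<^sub>1\<close> and \<open>\<beta>\<^sub>2\<close> are the gains
  in the exponent per unit of \<open>w\<close> and of \<open>v\<close>. The leading terms of
  \<open>\<beta>\<^sub>1\<close> cancel and leave \<open>- ln (ln x)\<close> up to a constant, while
  \<open>\<beta>\<^sub>2\<close> grows like \<open>ln x / 2\<close>, so the moduli decide.
  \<open>h1\<close> supplies enough primes, \<open>h2\<close> makes the moduli small,
  \<open>h3\<close> bounds the number of primes dividing \<open>k\<close>, and \<open>h4\<close>,
  \<open>h5\<close> permit rounding \<open>v\<close> and \<open>w\<close>.\<close>

lemma many_unit_solutions_explicit: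
  fixes s :: nat and x :: real
  defines "x \<equiv> real s"
  defines "L \<equiv> ln (2 * x * ln x)"
  defines "\<beta>\<^sub>1 \<equiv> 2 * ln (sqrt x / 9) - L" and "\<beta>\<^sub>2 \<equiv> 2 * ln (x / 9) - ln (sqrt x) - L"
  assumes x: "x \<ge> 1000"
    and h1: "2 \<le> x * ln x" "x / 4 * L < (x * ln x - 1) / 2"
    and h2: "ln 2 + L / 3 \<le> ln (sqrt x / 9)"
    and h3: "sqrt x * L \<le> x / 4 * ln 2"
    and h4: "\<beta>\<^sub>2 \<ge> 0" and h5: "\<beta>\<^sub>1 + \<beta>\<^sub>2 / 4 \<ge> 0"
    and P0: "finite P0" "\<And>p. p \<in> P0 \<Longrightarrow> prime p" "4 * card P0 \<le> s"
  shows "\<exists>S U. finite S \<and> (\<forall>p\<in>S. prime p) \<and> P0 \<subseteq> S \<and> card S = s \<and>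
    finite U \<and> (\<forall>x\<in>U. S_unit S x \<and> S_unit S (1 - x)) \<and>
    exp (sqrt x / 2 * (\<beta>\<^sub>1 + \<beta>\<^sub>2 / 4) - ln 4) \<le> real (card U)"
proof -
  \<comment> \<open>\<open>y\<close> is even because \<open>chebyshev_lower\<close> concerns primes
    up to \<open>2 * n\<close>; rounding up keeps \<open>x * ln x \<le> y\<close>.\<close>
  define n where "n = nat \<lceil>x * ln x / 2\<rceil>"
  define y where "y = 2 * n"
  have y1: "x * ln x \<le> real y" unfolding y_def n_def by linarith
  have "real n < x * ln x / 2 + 1" unfolding n_def using h1(1) by linarith
  then have y2: "real y \<le> 2 * x * ln x" unfolding y_def using h1(1) by simp
  have y0: "real y \<ge> 2" using y1 h1(1) by linarith
  have n1: "n \<ge> 1" using y0 unfolding y_def by simp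
  have lny: "ln (real y) \<le> L" unfolding L_def using y2 y0 by (subst ln_le_cancel_iff) linarith+
  have lny0: "ln (real y) \<ge> 0" using y0 by simp
  have L0: "L \<ge> 0" using lny lny0 by linarith

  define sx where "sx = sqrt x"
  have sx2: "sx * sx = x" unfolding sx_def using x by simp
  have sx: "sx \<ge> 30" unfolding sx_def by (rule real_le_rsqrt) (use x in simp)
  define w where "w = nat \<lfloor>sx\<rfloor>"
  \<comment> \<open>A third of \<open>w\<close> keeps the moduli, roughly \<open>s\<close> to the
    power \<open>w / 3\<close>, below \<open>card X\<close>, roughly \<open>s\<close> to the power
    \<open>w / 2\<close>. With \<open>t = s div 8\<close> the sets \<open>T1\<close> and
    \<open>T2\<close> together use at most a quarter of the \<open>s\<close> places.\<close>
  define v where "v = w div 3"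
  define t where "t = s div 8"
  have w: "real w \<le> sx" "sx - 1 < real w" using sx unfolding w_def by linarith+
  have w12: "w \<ge> 29" using w sx by linarith
  \<comment> \<open>The bound \<open>w \<le> 4 * v\<close>, which survives the rounding, is the
    source of the factor \<open>1/4\<close> in front of \<open>\<beta>\<^sub>2\<close>.\<close>
  have v: "3 * real v \<le> real w" "real w \<le> 4 * real v" "v \<ge> 1"
    using w12 unfolding v_def by linarith+
  have t: "x / 9 \<le> real t" "8 * real t \<le> x" using x unfolding x_def t_def by linarith+
  have "9 * sx \<le> sx * sx" using sx by (intro mult_right_mono) auto
  then have "sx \<le> x / 9" using sx2 by simp
  then have wt: "real w \<le> real t" using w t by linarith
  have vw: "real v \<le> sx" using v w by linarith
  have t0: "real t > 0" using t x by linarith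

  define Pr where "Pr = {p::nat. prime p \<and> p \<le> y}"
  have finPr: "finite Pr" unfolding Pr_def by simp
  \<comment> \<open>With fewer primes, at most \<open>x / 4\<close>, Chebyshev's bound would give
    \<open>(y - 1) * ln 2 \<le> x / 4 * L\<close>, against \<open>h1\<close> and
    \<open>ln 2 \<ge> 1 / 2\<close>.\<close>
  have cPr: "2 * t \<le> card Pr"
  proof (rule ccontr)
    assume "\<not> 2 * t \<le> card Pr"
    then have c: "real (card Pr) \<le> x / 4" using t by linarith
    have ln2: "1 / 2 \<le> ln (2 :: real)"
      using ln_le_minus_one[of "1 / 2 :: real"] by (simp add: ln_div)
    have "2 ^ (y - 1) \<le> y ^ card Pr" using chebyshev_lower[OF n1] unfolding y_def Pr_def .
    then have "real (2 ^ (y - 1)) \<le> real (y ^ card Pr)" by (simp only: of_nat_le_iff)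
    then have "ln (real (2 ^ (y - 1))) \<le> ln (real (y ^ card Pr))"
      using y0 by (subst ln_le_cancel_iff) auto
    then have "real (y - 1) * ln 2 \<le> real (card Pr) * ln (real y)"
      using y0 by (simp add: ln_realpow)
    also have "\<dots> \<le> (x / 4) * L" using c lny lny0 x by (intro mult_mono) auto
    also have "\<dots> < (x * ln x - 1) * (1 / 2)" using h1 by simp
    also have "\<dots> \<le> (x * ln x - 1) * ln 2"
      using h1(1) ln2 by (intro mult_left_mono) auto
    also have "\<dots> \<le> real (y - 1) * ln 2" using y1 y0 by (intro mult_right_mono) auto
    finally show False by simp
  qed
  \<comment> \<open>At most \<open>t\<close> primes lie below \<open>t\<close>, so at least
    \<open>t\<close> of the \<open>2 * t\<close> available ones are large. \<open>T2\<close> is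
    taken from these, since the moduli need a lower bound; \<open>T1\<close> takes any
    \<open>t\<close> of the remaining primes.\<close>
  define Pr' where "Pr' = {p \<in> Pr. t \<le> p}"
  have "card (Pr - Pr') \<le> card {..<t}" by (rule card_mono) (auto simp: Pr'_def)
  moreover have "card (Pr - Pr') = card Pr - card Pr'"
    using finPr by (intro card_Diff_subset) (auto simp: Pr'_def)
  ultimately have "t \<le> card Pr'" using cPr by simp
  then obtain T2 where T2: "T2 \<subseteq> Pr'" "card T2 = t" "finite T2"
    by (metis obtain_subset_with_card_n)
  have T2Pr: "T2 \<subseteq> Pr" using T2 by (auto simp: Pr'_def)
  then have "card (Pr - T2) = card Pr - t" using T2 by (simp add: card_Diff_subset)
  then have "t \<le> card (Pr - T2)" using cPr by simp
  then obtain T1 where T1: "T1 \<subseteq> Pr - T2" "card T1 = t" "finite T1"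
    by (metis obtain_subset_with_card_n)

  define bw where "bw = t choose w"
  define bv where "bv = t choose v"
  have bw0: "bw > 0" "bv > 0" unfolding bw_def bv_def using wt v by auto
  \<comment> \<open>From \<open>t choose w \<ge> (t / w) ^ w\<close> with
    \<open>t \<ge> x / 9\<close> and \<open>w \<le> sqrt x\<close>.\<close>
  have bw: "real w * ln (sx / 9) \<le> ln (real bw)"
  proof -
    have "sx / 9 * real w \<le> sx / 9 * sx" using w sx by (intro mult_left_mono) auto
    also have "\<dots> \<le> real t" using t sx2 by simp
    finally have "sx / 9 \<le> real t / real w" using w12 by (simp add: field_simps)
    then have "(sx / 9) ^ w \<le> (real t / real w) ^ w" using sx by (intro power_mono) auto
    also have "\<dots> \<le> real bw" unfolding bw_def
      by (rule binomial_ge_n_over_k_pow_k) (use wt in auto)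
    finally have "ln ((sx / 9) ^ w) \<le> ln (real bw)" using sx bw0 by (subst ln_le_cancel_iff) auto
    then show ?thesis using sx by (simp add: ln_realpow)
  qed
  have bv: "real v * (ln (x / 9) - ln sx) \<le> ln (real bv)"
  proof -
    have "(x / 9) / sx \<le> real t / real v" using t vw v sx x by (intro frac_le) auto
    then have "((x / 9) / sx) ^ v \<le> (real t / real v) ^ v" using sx x by (intro power_mono) auto
    also have "\<dots> \<le> real bv" unfolding bv_def
      by (rule binomial_ge_n_over_k_pow_k) (use wt v in linarith)
    finally have "ln (((x / 9) / sx) ^ v) \<le> ln (real bv)"
      using sx x bw0 by (subst ln_le_cancel_iff) auto
    moreover have "ln (((x / 9) / sx) ^ v) = real v * (ln (x / 9) - ln sx)"
      using sx x by (subst ln_realpow) (auto simp: ln_div ln_mult)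
    ultimately show ?thesis by simp
  qed

  have large: "2 * y ^ v \<le> bw"
  proof -
    have "ln (real (2 * y ^ v)) = ln 2 + real v * ln (real y)"
      using y0 by (simp add: ln_mult ln_realpow)
    also have "\<dots> \<le> ln 2 + (real w / 3) * L"
      using v lny lny0 by (intro add_left_mono mult_mono) auto
    also have "\<dots> \<le> real w * ln 2 + (real w / 3) * L" using w12 by simp
    also have "\<dots> = real w * (ln 2 + L / 3)" by (simp add: algebra_simps)
    also have "\<dots> \<le> real w * ln (sx / 9)" using h2 unfolding sx_def by (intro mult_left_mono) auto
    also have "\<dots> \<le> ln (real bw)" by (rule bw)
    finally have "real (2 * y ^ v) \<le> real bw"
      using y0 bw0 by (subst (asm) ln_le_cancel_iff) auto
    then show ?thesis by (simp only: of_nat_le_iff)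
  qed

  have "\<exists>k\<in>{1..y ^ w}. \<forall>S. T1 \<union> T2 \<union> prime_factors k \<subseteq> S \<longrightarrow>
    (\<exists>U. finite U \<and> (\<forall>x\<in>U. S_unit S x \<and> S_unit S (1 - x)) \<and>
      (t choose w) ^ 2 * (t choose v) * t ^ v \<le> 4 * y ^ v * y ^ w * card U)"
  proof (rule unit_solutions_from_two_prime_sets)
    show "T1 \<inter> T2 = {}" using T1 by auto
    show "prime p \<and> p \<le> y" if "p \<in> T1 \<union> T2" for p using that T1 T2Pr by (auto simp: Pr_def)
    show "t \<le> p" if "p \<in> T2" for p using that T2 by (auto simp: Pr'_def)
    show "1 \<le> t" "1 \<le> y" using t0 y0 by auto
    show "2 * y ^ v \<le> t choose w" using large unfolding bw_def .
  qed (use T1 T2 in auto)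
  then obtain k where k: "k \<in> {1..y ^ w}" and kS: "\<And>S. T1 \<union> T2 \<union> prime_factors k \<subseteq> S \<Longrightarrow>
    (\<exists>U. finite U \<and> (\<forall>x\<in>U. S_unit S x \<and> S_unit S (1 - x)) \<and>
      bw ^ 2 * bv * t ^ v \<le> 4 * y ^ v * y ^ w * card U)"
    unfolding bw_def bv_def by blast

  have ck: "real (card (prime_factors k)) \<le> x / 4"
  proof -
    have "2 ^ card (prime_factors k) \<le> y ^ w"
      using two_power_card_prime_factors_le[of k] k by simp
    then have "real (2 ^ card (prime_factors k)) \<le> real (y ^ w)" by (simp only: of_nat_le_iff)
    then have "ln (real (2 ^ card (prime_factors k))) \<le> ln (real (y ^ w))"
      using y0 by (subst ln_le_cancel_iff) auto
    then have "real (card (prime_factors k)) * ln 2 \<le> real w * ln (real y)"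
      using y0 by (simp add: ln_realpow)
    also have "\<dots> \<le> sx * L" using w lny lny0 sx by (intro mult_mono) auto
    also have "\<dots> \<le> x / 4 * ln 2" using h3 unfolding sx_def .
    finally show ?thesis by simp
  qed
  \<comment> \<open>The budget: at most a quarter of \<open>s\<close> each for \<open>P0\<close>,
    for \<open>T1 \<union> T2\<close> and for the prime factors of \<open>k\<close>. The places left
    are filled with arbitrary further primes \<open>B\<close>.\<close>
  define S0 where "S0 = P0 \<union> T1 \<union> T2 \<union> prime_factors k"
  have finS0: "finite S0" unfolding S0_def using P0 T1 T2 by auto
  have primeS0: "prime p" if "p \<in> S0" for p
    using that P0 T1 T2Pr unfolding S0_def by (auto simp: Pr_def)
  have "card S0 \<le> card P0 + card T1 + card T2 + card (prime_factors k)"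
    unfolding S0_def by (meson card_Un_le add_le_mono1 le_trans)
  then have cS0: "card S0 \<le> s" using ck t P0(3) T1 T2 unfolding x_def by linarith
  have "infinite ({p. prime p} - S0)" using primes_infinite finS0 by (rule Diff_infinite_finite[rotated])
  then obtain B where B: "finite B" "card B = s - card S0" "B \<subseteq> {p. prime p} - S0"
    using infinite_arbitrarily_large by blast
  define S where "S = S0 \<union> B"
  have "card S = card S0 + card B" unfolding S_def using finS0 B by (intro card_Un_disjoint) auto
  then have cS: "card S = s" using B cS0 by simp
  have "T1 \<union> T2 \<union> prime_factors k \<subseteq> S" unfolding S_def S0_def by auto
  from kS[OF this] obtain U where U: "finite U" "\<And>x. x \<in> U \<Longrightarrow> S_unit S x \<and> S_unit S (1 - x)"
    "bw ^ 2 * bv * t ^ v \<le> 4 * y ^ v * y ^ w * card U" by blast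
  have "bw ^ 2 * bv * t ^ v > 0" using bw0 t0 by simp
  then have U0: "card U > 0" using U(3) by (metis bot_nat_0.not_eq_extremum le_zero_eq mult_0_right)
  have "real (bw ^ 2 * bv * t ^ v) \<le> real (4 * y ^ v * y ^ w * card U)"
    using U(3) by (simp only: of_nat_le_iff)
  then have "ln (real (bw ^ 2 * bv * t ^ v)) \<le> ln (real (4 * y ^ v * y ^ w * card U))"
    using bw0 t0 U0 y0 by (subst ln_le_cancel_iff) auto
  moreover have "ln (real (bw ^ 2 * bv * t ^ v)) =
      2 * ln (real bw) + ln (real bv) + real v * ln (real t)"
    using bw0 t0 by (simp add: ln_mult ln_realpow)
  moreover have "ln (real (4 * y ^ v * y ^ w * card U)) =
      ln 4 + real v * ln (real y) + real w * ln (real y) + ln (real (card U))"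
    using U0 y0 by (simp add: ln_mult ln_realpow)
  ultimately have main: "2 * ln (real bw) + ln (real bv) + real v * ln (real t) \<le>
      ln 4 + real v * ln (real y) + real w * ln (real y) + ln (real (card U))" by simp
  have 1: "real v * ln (x / 9) \<le> real v * ln (real t)"
    using t x by (intro mult_left_mono) auto
  have 2: "real v * ln (real y) \<le> real v * L" "real w * ln (real y) \<le> real w * L"
    using lny by (auto intro: mult_left_mono)
  \<comment> \<open>The rounded parameters are replaced by \<open>w \<ge> sx / 2\<close>, which
    needs the sign in \<open>h5\<close>, and \<open>v \<ge> w / 4\<close>, which needs
    \<open>h4\<close>.\<close>
  have "sx / 2 * (\<beta>\<^sub>1 + \<beta>\<^sub>2 / 4) - ln 4 \<le> real w * (\<beta>\<^sub>1 + \<beta>\<^sub>2 / 4) - ln 4"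
    using h5 w sx by (intro diff_right_mono mult_right_mono) auto
  also have "\<dots> = real w * \<beta>\<^sub>1 + (real w / 4) * \<beta>\<^sub>2 - ln 4" by (simp add: algebra_simps)
  also have "\<dots> \<le> real w * \<beta>\<^sub>1 + real v * \<beta>\<^sub>2 - ln 4"
    using v h4 by (intro diff_right_mono add_left_mono mult_right_mono) auto
  also have "\<dots> = 2 * (real w * ln (sx / 9)) + real v * (ln (x / 9) - ln sx) + real v * ln (x / 9)
      - ln 4 - real v * L - real w * L"
    unfolding \<beta>\<^sub>1_def \<beta>\<^sub>2_def sx_def by (simp add: algebra_simps)
  also have "\<dots> \<le> ln (real (card U))" using main 1 2 bw bv by linarith
  finally have "exp (sx / 2 * (\<beta>\<^sub>1 + \<beta>\<^sub>2 / 4) - ln 4) \<le> real (card U)"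
    using U0 by (metis exp_le_cancel_iff exp_ln of_nat_0_less_iff)
  moreover have "finite S" "\<forall>p\<in>S. prime p" "P0 \<subseteq> S"
    using finS0 B primeS0 unfolding S_def by (auto simp: S0_def)
  moreover have "\<forall>x\<in>U. S_unit S x \<and> S_unit S (1 - x)" using U(2) by simp
  ultimately show ?thesis using cS U(1) unfolding sx_def by (intro exI[of _ S] exI[of _ U] conjI)
qed

text \<open>The gain \<open>\<beta>\<^sub>1 + \<beta>\<^sub>2 / 4\<close> grows like
  \<open>ln x / 8\<close>, so the exponent has order \<open>sqrt s * ln s\<close> and eventually
  exceeds any multiple of \<open>sqrt (s / ln s)\<close>. The threshold \<open>C\<close> is uniform
  in \<open>P0\<close>, which is what makes the final \<open>s1\<close> computable.\<close>

lemma many_unit_solutions: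
  "\<exists>C. \<forall>s\<ge>C. \<forall>P0. finite P0 \<longrightarrow> (\<forall>p\<in>P0. prime p) \<longrightarrow> 4 * card P0 \<le> s \<longrightarrow>
    (\<exists>S U. finite S \<and> (\<forall>p\<in>S. prime p) \<and> P0 \<subseteq> S \<and> card S = s \<and>
      finite U \<and> (\<forall>x\<in>U. S_unit S x \<and> S_unit S (1 - x)) \<and>
      exp (4 * real s powr (1/2) * ln (real s) powr (-1/2)) \<le> real (card U))"
proof -
  define L where "L = (\<lambda>x::real. ln (2 * x * ln x))"
  define b1 where "b1 = (\<lambda>x. 2 * ln (sqrt x / 9) - L x)"
  define b2 where "b2 = (\<lambda>x. 2 * ln (x / 9) - ln (sqrt x) - L x)"
  note defs = b1_def b2_def L_def
  have "eventually (\<lambda>x::real. x \<ge> 1000) at_top" by (rule eventually_ge_at_top)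
  moreover have "eventually (\<lambda>x::real. 2 \<le> x * ln x) at_top" by real_asymp
  moreover have "eventually (\<lambda>x::real. x / 4 * L x < (x * ln x - 1) / 2) at_top"
    unfolding defs by real_asymp
  moreover have "eventually (\<lambda>x::real. ln 2 + L x / 3 \<le> ln (sqrt x / 9)) at_top"
    unfolding defs by real_asymp
  moreover have "eventually (\<lambda>x::real. sqrt x * L x \<le> x / 4 * ln 2) at_top"
    unfolding defs by real_asymp
  moreover have "eventually (\<lambda>x::real. b2 x \<ge> 0) at_top" unfolding defs by real_asymp
  moreover have "eventually (\<lambda>x::real. b1 x + b2 x / 4 \<ge> 0) at_top" unfolding defs by real_asymp
  moreover have "eventually (\<lambda>x::real. 4 * x powr (1/2) * ln x powr (-1/2) \<le>
      sqrt x / 2 * (b1 x + b2 x / 4) - ln 4) at_top" unfolding defs by real_asymp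
  ultimately have "eventually (\<lambda>x::real. x \<ge> 1000 \<and> 2 \<le> x * ln x \<and>
      x / 4 * L x < (x * ln x - 1) / 2 \<and> ln 2 + L x / 3 \<le> ln (sqrt x / 9) \<and>
      sqrt x * L x \<le> x / 4 * ln 2 \<and> b2 x \<ge> 0 \<and> b1 x + b2 x / 4 \<ge> 0 \<and>
      4 * x powr (1/2) * ln x powr (-1/2) \<le> sqrt x / 2 * (b1 x + b2 x / 4) - ln 4) at_top"
    by eventually_elim blast
  from eventually_compose_filterlim[OF this filterlim_real_sequentially]
  obtain C where C: "\<And>s x. s \<ge> C \<Longrightarrow> x = real s \<Longrightarrow> x \<ge> 1000 \<and> 2 \<le> x * ln x \<and>
      x / 4 * L x < (x * ln x - 1) / 2 \<and> ln 2 + L x / 3 \<le> ln (sqrt x / 9) \<and>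
      sqrt x * L x \<le> x / 4 * ln 2 \<and> b2 x \<ge> 0 \<and> b1 x + b2 x / 4 \<ge> 0 \<and>
      4 * x powr (1/2) * ln x powr (-1/2) \<le> sqrt x / 2 * (b1 x + b2 x / 4) - ln 4"
    unfolding eventually_sequentially by blast
  show ?thesis
  proof (intro exI[of _ C] allI impI)
    fix s :: nat and P0 :: "nat set"
    assume s: "C \<le> s" and P0: "finite P0" "\<forall>p\<in>P0. prime p" "4 * card P0 \<le> s"
    note Cs = C[OF s refl]
    have "\<exists>S U. finite S \<and> (\<forall>p\<in>S. prime p) \<and> P0 \<subseteq> S \<and> card S = s \<and>
      finite U \<and> (\<forall>x\<in>U. S_unit S x \<and> S_unit S (1 - x)) \<and>
      exp (sqrt (real s) / 2 * (b1 (real s) + b2 (real s) / 4) - ln 4) \<le> real (card U)"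
      unfolding defs by (rule many_unit_solutions_explicit) (use Cs P0 in \<open>simp_all add: defs\<close>)
    moreover have "exp (4 * real s powr (1/2) * ln (real s) powr (-1/2)) \<le>
        exp (sqrt (real s) / 2 * (b1 (real s) + b2 (real s) / 4) - ln 4)"
      using Cs by simp
    ultimately show "\<exists>S U. finite S \<and> (\<forall>p\<in>S. prime p) \<and> P0 \<subseteq> S \<and> card S = s \<and>
      finite U \<and> (\<forall>x\<in>U. S_unit S x \<and> S_unit S (1 - x)) \<and>
      exp (4 * real s powr (1/2) * ln (real s) powr (-1/2)) \<le> real (card U)"
      by (elim exE conjE) (intro exI conjI; (assumption | rule order_trans))
  qed
qed

section \<open>Polynomials vanishing on a hyperplane\<close>

definition monom_eval :: "(nat \<Rightarrow> complex) \<Rightarrow> (nat \<Rightarrow>\<^sub>0 nat) \<Rightarrow> complex" where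
  "monom_eval x m = (\<Prod>i\<in>Poly_Mapping.keys m. x i ^ Poly_Mapping.lookup m i)"

lemma monom_eval_superset:
  assumes "finite I" "Poly_Mapping.keys m \<subseteq> I"
  shows "monom_eval x m = (\<Prod>i\<in>I. x i ^ Poly_Mapping.lookup m i)"
  unfolding monom_eval_def using assms by (intro prod.mono_neutral_left) (auto simp: in_keys_iff)

lemma monom_eval_zero [simp]: "monom_eval x 0 = 1"
  by (simp add: monom_eval_def)

lemma monom_eval_single [simp]: "monom_eval x (Poly_Mapping.single i k) = x i ^ k"
  by (cases "k = 0") (auto simp: monom_eval_def)

lemma monom_eval_add: "monom_eval x (m + m') = monom_eval x m * monom_eval x m'"
proof -
  let ?I = "Poly_Mapping.keys m \<union> Poly_Mapping.keys m'"
  have "monom_eval x (m + m') = (\<Prod>i\<in>?I. x i ^ Poly_Mapping.lookup (m + m') i)"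
    by (rule monom_eval_superset) (auto dest: subsetD[OF Poly_Mapping.keys_add])
  also have "\<dots> = (\<Prod>i\<in>?I. x i ^ Poly_Mapping.lookup m i) * (\<Prod>i\<in>?I. x i ^ Poly_Mapping.lookup m' i)"
    by (simp add: lookup_add power_add prod.distrib)
  also have "\<dots> = monom_eval x m * monom_eval x m'"
    using monom_eval_superset[of ?I m x] monom_eval_superset[of ?I m' x] by simp
  finally show ?thesis .
qed

lemma poly_eval_superset:
  assumes "finite K" "Poly_Mapping.keys P \<subseteq> K"
  shows "poly_eval x P = (\<Sum>m\<in>K. Poly_Mapping.lookup P m * monom_eval x m)"
  unfolding poly_eval_def monom_eval_def using assms
  by (intro sum.mono_neutral_left) (auto simp: in_keys_iff)

lemma poly_eval_zero [simp]: "poly_eval x 0 = 0"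
  by (simp add: poly_eval_def)

lemma poly_eval_single [simp]: "poly_eval x (Poly_Mapping.single m c) = c * monom_eval x m"
  by (subst poly_eval_superset[of "{m}"]) auto

lemma poly_eval_add: "poly_eval x (P + Q) = poly_eval x P + poly_eval x Q"
proof -
  let ?K = "Poly_Mapping.keys P \<union> Poly_Mapping.keys Q"
  have "poly_eval x (P + Q) = (\<Sum>m\<in>?K. Poly_Mapping.lookup (P + Q) m * monom_eval x m)"
    by (rule poly_eval_superset) (auto dest: subsetD[OF Poly_Mapping.keys_add])
  also have "\<dots> = (\<Sum>m\<in>?K. Poly_Mapping.lookup P m * monom_eval x m) +
      (\<Sum>m\<in>?K. Poly_Mapping.lookup Q m * monom_eval x m)"
    by (simp add: lookup_add algebra_simps sum.distrib)
  also have "\<dots> = poly_eval x P + poly_eval x Q"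
    using poly_eval_superset[of ?K P x] poly_eval_superset[of ?K Q x] by simp
  finally show ?thesis .
qed

lemma poly_eval_sum: "poly_eval x (\<Sum>i\<in>I. f i) = (\<Sum>i\<in>I. poly_eval x (f i))"
  by (induction I rule: infinite_finite_induct) (auto simp: poly_eval_add)

lemma cpoly_eq_sum_single:
  "(P :: cpoly) = (\<Sum>m\<in>Poly_Mapping.keys P. Poly_Mapping.single m (Poly_Mapping.lookup P m))"
proof (rule poly_mapping_eqI)
  fix k
  show "Poly_Mapping.lookup P k = Poly_Mapping.lookup
      (\<Sum>m\<in>Poly_Mapping.keys P. Poly_Mapping.single m (Poly_Mapping.lookup P m)) k"
    by (simp add: lookup_sum lookup_single when_def in_keys_iff)
qed

lemma poly_eval_mult: "poly_eval x (P * Q) = poly_eval x P * poly_eval x Q"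
proof -
  let ?s = "\<lambda>P m. Poly_Mapping.single m (Poly_Mapping.lookup (P :: cpoly) m)"
  have "P * Q = (\<Sum>m\<in>Poly_Mapping.keys P. ?s P m) * (\<Sum>m\<in>Poly_Mapping.keys Q. ?s Q m)"
    by (simp only: cpoly_eq_sum_single[symmetric])
  also have "poly_eval x \<dots> = poly_eval x P * poly_eval x Q"
    by (simp add: sum_product poly_eval_sum mult_single monom_eval_add)
      (simp add: poly_eval_superset[OF finite_keys order_refl] sum_product mult_ac)
  finally show ?thesis .
qed

lemma poly_eval_one [simp]: "poly_eval x 1 = 1"
  using poly_eval_single[of x 0 1] by (simp del: poly_eval_single)

lemma poly_eval_diff: "poly_eval x (P - Q) = poly_eval x P - poly_eval x Q"
  using poly_eval_add[of x "P - Q" Q] by simp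

lemma poly_eval_hyperplane_poly:
  "poly_eval x (hyperplane_poly a) = (\<Sum>i<length a. of_rat (a ! i) * x i) - 1"
  unfolding hyperplane_poly_def by (simp add: poly_eval_diff poly_eval_sum)

section \<open>The ring of polynomials in the first \<open>n\<close> variables\<close>

lemma polys_in_add: "P \<in> polys_in n \<Longrightarrow> Q \<in> polys_in n \<Longrightarrow> P + Q \<in> polys_in n"
  unfolding polys_in_def using Poly_Mapping.keys_add[of P Q] by blast

lemma polys_in_diff: "P \<in> polys_in n \<Longrightarrow> Q \<in> polys_in n \<Longrightarrow> P - Q \<in> polys_in n"
proof -
  have "m \<in> Poly_Mapping.keys P \<or> m \<in> Poly_Mapping.keys Q" if "m \<in> Poly_Mapping.keys (P - Q)" for m
    using that by (auto simp: in_keys_iff lookup_minus)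
  then show "P \<in> polys_in n \<Longrightarrow> Q \<in> polys_in n \<Longrightarrow> P - Q \<in> polys_in n"
    unfolding polys_in_def by blast
qed

lemma polys_in_mult:
  assumes "P \<in> polys_in n" "Q \<in> polys_in n"
  shows "P * Q \<in> polys_in n"
  unfolding polys_in_def
proof (intro CollectI ballI)
  fix m assume "m \<in> Poly_Mapping.keys (P * Q)"
  then obtain m1 m2 where m: "m = m1 + m2" "m1 \<in> Poly_Mapping.keys P" "m2 \<in> Poly_Mapping.keys Q"
    using keys_mult[of P Q] by auto
  have "Poly_Mapping.keys m \<subseteq> Poly_Mapping.keys m1 \<union> Poly_Mapping.keys m2"
    unfolding m(1) by (rule Poly_Mapping.keys_add)
  also have "\<dots> \<subseteq> {..<n}" using m assms by (auto simp: polys_in_def)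
  finally show "Poly_Mapping.keys m \<subseteq> {..<n}" .
qed

lemma polys_in_sum: "(\<And>i. i \<in> I \<Longrightarrow> f i \<in> polys_in n) \<Longrightarrow> sum f I \<in> polys_in n"
proof (induction I rule: infinite_finite_induct)
  case (insert i I)
  then show ?case by (simp add: polys_in_add)
qed (auto simp: polys_in_def)

lemma polys_in_const: "Poly_Mapping.single 0 c \<in> polys_in n"
  by (auto simp: polys_in_def)

lemma polys_in_var: "i < n \<Longrightarrow> Poly_Mapping.single (Poly_Mapping.single i 1) c \<in> polys_in n"
  by (auto simp: polys_in_def)

lemma polys_in_mono: "P \<in> polys_in n \<Longrightarrow> n \<le> n' \<Longrightarrow> P \<in> polys_in n'"
  unfolding polys_in_def by (auto simp: subset_iff intro: less_le_trans)

lemma polys_in_one: "1 \<in> polys_in n"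
  using polys_in_const[of 1 n] by simp

lemma monom_eq_sum_single:
  "m = (\<Sum>i\<in>Poly_Mapping.keys m. Poly_Mapping.single i (Poly_Mapping.lookup m i))"
  for m :: "nat \<Rightarrow>\<^sub>0 nat"
proof (rule poly_mapping_eqI)
  fix k
  show "Poly_Mapping.lookup m k = Poly_Mapping.lookup
      (\<Sum>i\<in>Poly_Mapping.keys m. Poly_Mapping.single i (Poly_Mapping.lookup m i)) k"
    by (simp add: lookup_sum lookup_single when_def in_keys_iff)
qed

lemma single_sum_eq_prod:
  "Poly_Mapping.single (\<Sum>i\<in>I. f i) (1::complex) = (\<Prod>i\<in>I. Poly_Mapping.single (f i) 1)"
  for f :: "nat \<Rightarrow> (nat \<Rightarrow>\<^sub>0 nat)"
proof (induction I rule: infinite_finite_induct)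
  case (insert i I)
  have "Poly_Mapping.single (sum f (insert i I)) (1::complex) =
      Poly_Mapping.single (f i) 1 * Poly_Mapping.single (sum f I) 1"
    using insert.hyps by (simp add: mult_single)
  also have "\<dots> = (\<Prod>j\<in>insert i I. Poly_Mapping.single (f j) 1)"
    by (simp add: insert)
  finally show ?case .
qed auto

lemma single_var_power:
  "Poly_Mapping.single (Poly_Mapping.single i k) (1::complex) =
    Poly_Mapping.single (Poly_Mapping.single i 1) 1 ^ k" for i k :: nat
proof (induction k)
  case (Suc k)
  have "Poly_Mapping.single i (Suc k) = Poly_Mapping.single i 1 + Poly_Mapping.single i k"
    by (simp add: single_add[symmetric])
  then have "Poly_Mapping.single (Poly_Mapping.single i (Suc k)) (1::complex) =
      Poly_Mapping.single (Poly_Mapping.single i 1) 1 * Poly_Mapping.single (Poly_Mapping.single i k) 1"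
    by (simp add: mult_single)
  then show ?case using Suc by simp
qed simp

text \<open>Modulo the hyperplane polynomial, the last variable is an affine expression in the
  others, because its coefficient is invertible. The set \<open>D\<close> of all
  \<open>H * Q + R\<close> is therefore closed under sums and products and contains the constants
  and every variable, hence all polynomials; no division algorithm is run.\<close>

lemma hyperplane_poly_division:
  assumes a: "length a = Suc n" "a ! n \<noteq> 0" and P: "P \<in> polys_in (Suc n)"
  obtains Q R where "Q \<in> polys_in (Suc n)" "R \<in> polys_in n" "P = hyperplane_poly a * Q + R"
proof -
  define H where "H = hyperplane_poly a"
  define D where "D = {H * Q + R | Q R. Q \<in> polys_in (Suc n) \<and> R \<in> polys_in n}"
  define X where "X = (\<lambda>i c. Poly_Mapping.single (Poly_Mapping.single i 1) c :: cpoly)"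
  have up: "R \<in> polys_in (Suc n)" if "R \<in> polys_in n" for R using polys_in_mono that by simp
  have H: "H \<in> polys_in (Suc n)" unfolding H_def hyperplane_poly_def a
    by (intro polys_in_diff polys_in_sum polys_in_one polys_in_var) auto
  have DI: "H * Q + R \<in> D" if "Q \<in> polys_in (Suc n)" "R \<in> polys_in n" for Q R
    using that by (auto simp: D_def)
  have Dadd: "P + P' \<in> D" if "P \<in> D" "P' \<in> D" for P P'
  proof -
    from that(1) obtain Q R where 1: "Q \<in> polys_in (Suc n)" "R \<in> polys_in n" "P = H * Q + R"
      unfolding D_def by blast
    from that(2) obtain Q' R' where 2: "Q' \<in> polys_in (Suc n)" "R' \<in> polys_in n" "P' = H * Q' + R'"
      unfolding D_def by blast
    note * = 1 2
    have "P + P' = H * (Q + Q') + (R + R')" unfolding * by (simp add: algebra_simps)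
    then show ?thesis using DI[of "Q + Q'" "R + R'"] * polys_in_add by metis
  qed
  have Dmult: "P * P' \<in> D" if "P \<in> D" "P' \<in> D" for P P'
  proof -
    from that(1) obtain Q R where 1: "Q \<in> polys_in (Suc n)" "R \<in> polys_in n" "P = H * Q + R"
      unfolding D_def by blast
    from that(2) obtain Q' R' where 2: "Q' \<in> polys_in (Suc n)" "R' \<in> polys_in n" "P' = H * Q' + R'"
      unfolding D_def by blast
    note * = 1 2
    have "P * P' = H * (Q * (H * Q' + R') + R * Q') + R * R'" unfolding * by (simp add: algebra_simps)
    moreover have "Q * (H * Q' + R') + R * Q' \<in> polys_in (Suc n)" "R * R' \<in> polys_in n"
      using * H up by (auto intro!: polys_in_add polys_in_mult)
    ultimately show ?thesis using DI by metis
  qed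
  have Dlow: "R \<in> D" if "R \<in> polys_in n" for R
    using DI[of 0 R] that by (simp add: polys_in_def)
  have Dconst: "Poly_Mapping.single 0 c \<in> D" for c by (rule Dlow[OF polys_in_const])
  have Dvar: "X i 1 \<in> D" if i: "i < Suc n" for i
  proof (cases "i < n")
    case True
    then show ?thesis unfolding X_def by (intro Dlow polys_in_var)
  next
    case False
    then have i: "i = n" using i by simp
    define c :: cpoly where "c = Poly_Mapping.single 0 (inverse (of_rat (a ! n)))"
    define s where "s = (\<Sum>i<n. X i (of_rat (a ! i)))"
    have "X n (of_rat (a ! n)) = H + 1 - s"
      unfolding H_def hyperplane_poly_def a X_def s_def by simp
    moreover have "c * X n (of_rat (a ! n)) = X n 1"
      unfolding c_def X_def using a by (simp add: mult_single)
    ultimately have "X n 1 = c * (H + 1 - s)" by simp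
    also have "\<dots> = H * c + c * (1 - s)" by (simp add: algebra_simps)
    finally have "X n 1 = H * c + c * (1 - s)" .
    moreover have "c \<in> polys_in (Suc n)" unfolding c_def by (rule polys_in_const)
    moreover have "c * (1 - s) \<in> polys_in n" unfolding c_def s_def X_def
      by (intro polys_in_mult polys_in_diff polys_in_sum polys_in_one polys_in_const polys_in_var) auto
    ultimately show ?thesis unfolding i using DI by metis
  qed
  have Dpow: "P ^ k \<in> D" if "P \<in> D" for P k
    using that Dconst[of 1] by (induction k) (auto intro: Dmult)
  have Dprod: "prod f I \<in> D" if "\<And>i. i \<in> I \<Longrightarrow> f i \<in> D" for f :: "nat \<Rightarrow> cpoly" and I
    using that Dconst[of 1] by (induction I rule: infinite_finite_induct) (auto intro: Dmult)
  have Dsum: "sum f I \<in> D" if "\<And>i. i \<in> I \<Longrightarrow> f i \<in> D" for f :: "(nat \<Rightarrow>\<^sub>0 nat) \<Rightarrow> cpoly" and I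
    using that Dconst[of 0] by (induction I rule: infinite_finite_induct) (auto intro: Dadd)
  have Dmonom: "Poly_Mapping.single m c \<in> D" if m: "Poly_Mapping.keys m \<subseteq> {..<Suc n}" for m c
  proof -
    have "Poly_Mapping.single m c = Poly_Mapping.single 0 c * Poly_Mapping.single m 1"
      by (simp add: mult_single)
    also have "Poly_Mapping.single m (1::complex) =
        (\<Prod>i\<in>Poly_Mapping.keys m. X i 1 ^ Poly_Mapping.lookup m i)"
      unfolding X_def single_var_power[symmetric] single_sum_eq_prod[symmetric]
      by (simp only: monom_eq_sum_single[symmetric])
    finally show ?thesis
      using m by (auto intro!: Dmult Dconst Dprod Dpow Dvar)
  qed
  have "P \<in> D"
    by (subst cpoly_eq_sum_single[of P]) (use P in \<open>auto intro!: Dsum Dmonom simp: polys_in_def\<close>)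
  then show thesis using that unfolding D_def H_def by blast
qed

lemma monomials_independent_on_grid:
  fixes e :: "'m \<Rightarrow> nat \<Rightarrow> nat" and c :: "'m \<Rightarrow> complex"
  assumes "finite K" and "\<And>m m'. m \<in> K \<Longrightarrow> m' \<in> K \<Longrightarrow> (\<And>i. i < n \<Longrightarrow> e m i = e m' i) \<Longrightarrow> m = m'"
    and "\<And>i. i < n \<Longrightarrow> infinite (G i)"
    and "\<And>x. (\<And>i. i < n \<Longrightarrow> x i \<in> G i) \<Longrightarrow> (\<Sum>m\<in>K. c m * (\<Prod>i<n. x i ^ e m i)) = 0"
    and "m \<in> K"
  shows "c m = 0"
  using assms
proof (induction n arbitrary: K m)
  \<comment> \<open>Without variables all exponents agree vacuously, so \<open>K\<close> is a
    singleton and the sum is \<open>c m\<close> itself.\<close>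
  case 0
  then have "K = {m}" by auto
  then show ?case using "0.prems"(4)[of undefined] by simp
next
  case (Suc n)
  define k where "k = e m n"
  define K' where "K' = {m' \<in> K. e m' n = k}"
  show ?case
  proof (rule Suc.IH[of K'])
    show "finite K'" "m \<in> K'" using Suc.prems by (auto simp: K'_def k_def)
    show "m1 = m2" if "m1 \<in> K'" "m2 \<in> K'" "\<And>i. i < n \<Longrightarrow> e m1 i = e m2 i" for m1 m2
    proof (rule Suc.prems(2))
      show "e m1 i = e m2 i" if "i < Suc n" for i
        using \<open>m1 \<in> K'\<close> \<open>m2 \<in> K'\<close> that \<open>\<And>i. i < n \<Longrightarrow> e m1 i = e m2 i\<close>
        by (cases "i = n") (auto simp: K'_def)
    qed (use that in \<open>auto simp: K'_def\<close>)
    show "infinite (G i)" if "i < n" for i using that Suc.prems(3) by simp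
    fix x assume x: "\<And>i. i < n \<Longrightarrow> x i \<in> G i"
    define p where "p = (\<Sum>m\<in>K. Polynomial.monom (c m * (\<Prod>i<n. x i ^ e m i)) (e m n))"
    have "poly p z = 0" if z: "z \<in> G n" for z
    proof -
      have "(\<Sum>m\<in>K. c m * (\<Prod>i<Suc n. (x(n := z)) i ^ e m i)) = 0"
        by (rule Suc.prems(4)) (use x z in \<open>auto simp: less_Suc_eq\<close>)
      then show ?thesis
        unfolding p_def poly_sum by (simp add: poly_monom mult_ac)
    qed
    then have "G n \<subseteq> {z. poly p z = 0}" by auto
    then have "infinite {z. poly p z = 0}" using Suc.prems(3)[of n] finite_subset by blast
    then have "p = 0" using poly_roots_finite by blast
    then have "coeff p k = 0" by simp
    then have "(\<Sum>m\<in>K. if e m n = k then c m * (\<Prod>i<n. x i ^ e m i) else 0) = 0"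
      unfolding p_def coeff_sum coeff_monom .
    then show "(\<Sum>m\<in>K'. c m * (\<Prod>i<n. x i ^ e m i)) = 0"
      unfolding K'_def using Suc.prems(1) by (simp add: sum.inter_filter)
  qed
qed

lemma poly_eval_grid_zero_imp_zero:
  assumes R: "R \<in> polys_in n" and G: "\<And>i. i < n \<Longrightarrow> infinite (G i)"
    and zero: "\<And>x. (\<And>i. i < n \<Longrightarrow> x i \<in> G i) \<Longrightarrow> poly_eval x R = 0"
  shows "R = 0"
proof (rule ccontr)
  assume "R \<noteq> 0"
  then obtain m where m: "m \<in> Poly_Mapping.keys R" by fastforce
  have keys: "Poly_Mapping.keys m' \<subseteq> {..<n}" if "m' \<in> Poly_Mapping.keys R" for m'
    using R that by (auto simp: polys_in_def)
  have "Poly_Mapping.lookup R m = 0"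
  proof (rule monomials_independent_on_grid[of "Poly_Mapping.keys R" n Poly_Mapping.lookup G])
    fix m1 m2 assume *: "m1 \<in> Poly_Mapping.keys R" "m2 \<in> Poly_Mapping.keys R"
      and eq: "\<And>i. i < n \<Longrightarrow> Poly_Mapping.lookup m1 i = Poly_Mapping.lookup m2 i"
    show "m1 = m2"
    proof (rule poly_mapping_eqI)
      fix i
      show "Poly_Mapping.lookup m1 i = Poly_Mapping.lookup m2 i"
        using eq[of i] keys[OF *(1)] keys[OF *(2)]
        by (cases "i < n") (simp, metis in_keys_iff lessThan_iff subsetD)
    qed
  next
    fix x :: "nat \<Rightarrow> complex" assume x: "\<And>i. i < n \<Longrightarrow> x i \<in> G i"
    have "(\<Sum>m\<in>Poly_Mapping.keys R. Poly_Mapping.lookup R m * (\<Prod>i<n. x i ^ Poly_Mapping.lookup m i)) =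
        poly_eval x R"
      unfolding poly_eval_superset[OF finite_keys order_refl]
      by (intro sum.cong refl) (use keys in \<open>simp add: monom_eval_superset[of "{..<n}"]\<close>)
    then show "(\<Sum>m\<in>Poly_Mapping.keys R. Poly_Mapping.lookup R m * (\<Prod>i<n. x i ^ Poly_Mapping.lookup m i)) = 0"
      using zero x by metis
  qed (use G m in auto)
  then show False using m by (simp add: in_keys_iff)
qed

section \<open>Equations in several unknowns\<close>

lemma poly_eval_cong:
  assumes "P \<in> polys_in n" "\<And>i. i < n \<Longrightarrow> x i = y i"
  shows "poly_eval x P = poly_eval y P"
  unfolding poly_eval_def
proof (intro sum.cong arg_cong2[of _ _ _ _ times] prod.cong refl)
  fix m i assume "m \<in> Poly_Mapping.keys P" "i \<in> Poly_Mapping.keys m"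
  then have "i < n" using assms(1) by (auto simp: polys_in_def)
  then show "x i ^ Poly_Mapping.lookup m i = y i ^ Poly_Mapping.lookup m i" using assms(2) by simp
qed

text \<open>A product of affine factors has degree at most the number of factors, so a monomial
  yields at most the sum of its exponents.\<close>

lemma poly_eval_of_affine:
  assumes "\<And>i. degree (q i) \<le> 1"
  shows "\<exists>p. degree p \<le> total_degree P \<and> (\<forall>z. poly_eval (\<lambda>i. poly (q i) z) P = poly p z)"
proof (intro exI conjI allI)
  define r where "r = (\<lambda>m. \<Prod>i\<in>Poly_Mapping.keys m. q i ^ Poly_Mapping.lookup m i)"
  define p where "p = (\<Sum>m\<in>Poly_Mapping.keys P. smult (Poly_Mapping.lookup P m) (r m))"
  show "poly_eval (\<lambda>i. poly (q i) z) P = poly p z" for z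
    unfolding p_def r_def poly_eval_def by (simp add: poly_sum poly_prod)
  show "degree p \<le> total_degree P"
    unfolding p_def
  proof (rule degree_sum_le)
    fix m assume m: "m \<in> Poly_Mapping.keys P"
    have "degree (smult (Poly_Mapping.lookup P m) (r m)) \<le> degree (r m)" by (rule degree_smult_le)
    also have "\<dots> \<le> (\<Sum>i\<in>Poly_Mapping.keys m. degree (q i ^ Poly_Mapping.lookup m i))"
      unfolding r_def using degree_prod_sum_le[OF finite_keys] by (simp add: comp_def)
    also have "\<dots> \<le> (\<Sum>i\<in>Poly_Mapping.keys m. Poly_Mapping.lookup m i)"
    proof (rule sum_mono)
      fix i
      have "degree (q i ^ Poly_Mapping.lookup m i) \<le> degree (q i) * Poly_Mapping.lookup m i"
        by (rule degree_power_le)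
      also have "\<dots> \<le> Poly_Mapping.lookup m i" using assms[of i] by (cases "degree (q i)") auto
      finally show "degree (q i ^ Poly_Mapping.lookup m i) \<le> Poly_Mapping.lookup m i" .
    qed
    also have "\<dots> \<le> total_degree P"
      unfolding total_degree_def using m by (intro Max_ge) auto
    finally show "degree (smult (Poly_Mapping.lookup P m) (r m)) \<le> total_degree P" .
  qed simp
qed

text \<open>The coordinates are freed one at a time: with those below \<open>k\<close> arbitrary and
  the others in \<open>V\<close>, the dependence on coordinate \<open>k\<close> is a polynomial of
  degree at most \<open>d\<close> with more than \<open>d\<close> zeros. Only the degree in each
  single variable is bounded, which is all that composition with \<open>split_point\<close>
  provides.\<close>

lemma separately_polynomial_zero_on_grid:
  fixes f :: "(nat \<Rightarrow> complex) \<Rightarrow> complex"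
  assumes f: "\<And>j u. j < N \<Longrightarrow> \<exists>p. degree p \<le> d \<and> (\<forall>z. f (u(j := z)) = poly p z)"
    and V: "finite V" "d < card V"
    and zero: "\<And>u. (\<And>j. j < N \<Longrightarrow> u j \<in> V) \<Longrightarrow> f u = 0"
  shows "f u = 0"
proof -
  have "f u = 0" if "k \<le> N" "\<And>j. k \<le> j \<Longrightarrow> j < N \<Longrightarrow> u j \<in> V" for k u
    using that
  proof (induction k arbitrary: u)
    case 0
    then show ?case by (intro zero) auto
  next
    case (Suc k)
    obtain p where p: "degree p \<le> d" "\<And>z. f (u(k := z)) = poly p z"
      using f[of k u] Suc.prems by auto
    have "poly p z = 0" if "z \<in> V" for z
      unfolding p(2)[symmetric] by (rule Suc.IH) (use Suc.prems that in \<open>auto simp: Suc_le_eq\<close>)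
    then have "V \<subseteq> {z. poly p z = 0}" by auto
    moreover have "p \<noteq> 0 \<Longrightarrow> card {z. poly p z = 0} \<le> d"
      using card_poly_roots_bound[of p] p(1) by simp
    ultimately have "p = 0"
      using V poly_roots_finite[of p] by (meson card_mono leD le_trans)
    then show ?case using p(2)[of "u k"] by simp
  qed
  from this[of N u] show ?thesis by simp
qed

text \<open>Iterating \<open>1 = u + (1 - u)\<close> on the last summand turns solutions of the equation in two
  unknowns into solutions of the equation with coefficients \<open>b 0, \<dots>, b N\<close>.\<close>

definition split_point :: "(nat \<Rightarrow> 'a::field) \<Rightarrow> nat \<Rightarrow> (nat \<Rightarrow> 'a) \<Rightarrow> nat \<Rightarrow> 'a" where
  "split_point b N u i = (\<Prod>j<i. 1 - u j) * (if i < N then u i else 1) / b i"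

lemma split_point_sum:
  assumes "\<And>i. i \<le> N \<Longrightarrow> b i \<noteq> 0"
  shows "(\<Sum>i<Suc N. b i * split_point b N u i) = 1"
proof -
  \<comment> \<open>Telescoping: at each step the remainder splits into its parts \<open>u i\<close>
    and \<open>1 - u i\<close>.\<close>
  have "(\<Sum>i<k. (\<Prod>j<i. 1 - u j) * u i) + (\<Prod>j<k. 1 - u j) = 1" for k
    by (induction k) (auto simp: algebra_simps)
  moreover have "(\<Sum>i<N. b i * split_point b N u i) = (\<Sum>i<N. (\<Prod>j<i. 1 - u j) * u i)"
    using assms by (intro sum.cong) (auto simp: split_point_def)
  moreover have "b N * split_point b N u N = (\<Prod>j<N. 1 - u j)"
    using assms[of N] by (simp add: split_point_def)
  ultimately show ?thesis by (simp only: sum.lessThan_Suc)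
qed

text \<open>The parameter \<open>u j\<close> enters coordinate \<open>i\<close> through at most one
  factor: \<open>1 - u j\<close> if \<open>j < i\<close>, \<open>u j\<close> if
  \<open>j = i < N\<close>, and none otherwise.\<close>

lemma split_point_affine:
  "\<exists>q :: complex poly. degree q \<le> 1 \<and> (\<forall>z. split_point b N (u(j := z)) i = poly q z)"
proof (cases "j < i")
  case True
  define c where "c = (\<Prod>k\<in>{..<i} - {j}. 1 - u k) * (if i < N then u i else 1) / b i"
  have "(\<Prod>k<i. 1 - (u(j := z)) k) = (1 - z) * (\<Prod>k\<in>{..<i} - {j}. 1 - u k)" for z
    using True by (subst prod.remove[of _ j]) auto
  then have *: "split_point b N (u(j := z)) i = (1 - z) * c" for z
    unfolding split_point_def c_def using True by simp
  have "split_point b N (u(j := z)) i = poly [:c, - c:] z" for z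
    unfolding * by (simp add: algebra_simps)
  then show ?thesis by (intro exI[of _ "[:c, - c:]"]) auto
next
  case False
  define c where "c = (\<Prod>k<i. 1 - u k) / b i"
  have c: "(\<Prod>k<i. 1 - (u(j := z)) k) / b i = c" for z
    unfolding c_def using False by (intro arg_cong2[of _ _ _ _ divide] prod.cong) auto
  show ?thesis
  proof (cases "i = j \<and> i < N")
    case True
    then have "split_point b N (u(j := z)) i = poly [:0, c:] z" for z
      using c[of z] by (auto simp: split_point_def)
    then show ?thesis by (intro exI[of _ "[:0, c:]"]) auto
  next
    case F: False
    then have "split_point b N (u(j := z)) i = poly [:c * (if i < N then u i else 1):] z" for z
      using c[of z] by (auto simp: split_point_def)
    then show ?thesis by (intro exI[of _ "[:c * (if i < N then u i else 1):]"]) auto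
  qed
qed

text \<open>\<open>\<sigma> i\<close> is what is left of \<open>1\<close> after the first
  \<open>i\<close> summands, and \<open>u i\<close> must be the fraction of it spent on summand
  \<open>i\<close>; the second hypothesis keeps the remainders non-zero. Matching the coordinates
  below \<open>N\<close> suffices for a polynomial in \<open>N\<close> variables.\<close>

lemma split_point_surj:
  fixes x :: "nat \<Rightarrow> 'a::field"
  assumes "\<And>i. i < N \<Longrightarrow> b i \<noteq> 0" "\<And>i. i \<le> N \<Longrightarrow> (\<Sum>j<i. b j * x j) \<noteq> 1"
  shows "\<exists>u. \<forall>i<N. split_point b N u i = x i"
proof (intro exI allI impI)
  define \<sigma> where "\<sigma> = (\<lambda>i. 1 - (\<Sum>j<i. b j * x j))"
  define u where "u = (\<lambda>i. b i * x i / \<sigma> i)"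
  have \<sigma>: "\<sigma> i \<noteq> 0" if "i \<le> N" for i using assms(2)[OF that] by (simp add: \<sigma>_def)
  have prod: "(\<Prod>j<i. 1 - u j) = \<sigma> i" if "i \<le> N" for i
    using that
  proof (induction i)
    case 0
    then show ?case by (simp add: \<sigma>_def)
  next
    case (Suc i)
    have "\<sigma> i * (1 - u i) = \<sigma> i - b i * x i" using \<sigma>[of i] Suc.prems by (simp add: u_def field_simps)
    also have "\<dots> = \<sigma> (Suc i)" by (simp add: \<sigma>_def)
    finally show ?case using Suc by simp
  qed
  show "split_point b N u i = x i" if "i < N" for i
    using that assms(1)[OF that] prod[of i] \<sigma>[of i] by (simp add: split_point_def u_def)
qed

text \<open>Reduce \<open>P\<close> to a remainder \<open>R\<close> free of the last variable. Split
  points lie on the hyperplane, so \<open>R\<close> vanishes at them, and their first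
  \<open>N\<close> coordinates cover an infinite grid; thus \<open>R = 0\<close>.\<close>

lemma poly_eval_split_point_zero_imp_dvd:
  assumes len: "length a = Suc N" and nz: "\<And>i. i < Suc N \<Longrightarrow> a ! i \<noteq> 0"
    and P: "P \<in> polys_in (Suc N)"
    and zero: "\<And>u. poly_eval (split_point (\<lambda>i. of_rat (a ! i)) N u) P = 0"
  shows "\<exists>Q \<in> polys_in (Suc N). P = hyperplane_poly a * Q"
proof -
  define b where "b = (\<lambda>i. of_rat (a ! i) :: complex)"
  obtain Q R where QR: "Q \<in> polys_in (Suc N)" "R \<in> polys_in N" "P = hyperplane_poly a * Q + R"
    using hyperplane_poly_division[OF len _ P] nz by blast
  have zeroR: "poly_eval (split_point b N u) R = 0" for u
  proof -
    have "poly_eval (split_point b N u) (hyperplane_poly a) = 0"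
      using split_point_sum[of N b u] nz unfolding poly_eval_hyperplane_poly len b_def by simp
    then show ?thesis
      using zero[of u] unfolding QR(3) b_def by (simp add: poly_eval_add poly_eval_mult)
  qed
  \<comment> \<open>On this grid all partial sums of \<open>a\<^sub>i x\<^sub>i\<close> are non-positive integers, hence never \<open>1\<close>.\<close>
  define G where "G = (\<lambda>i. range (\<lambda>k::nat. - of_nat k / b i))"
  have "R = 0"
  proof (rule poly_eval_grid_zero_imp_zero[OF QR(2)])
    fix i assume "i < N"
    then have "inj (\<lambda>k::nat. - of_nat k / b i)" using nz[of i] by (auto simp: inj_def b_def)
    then show "infinite (G i)" unfolding G_def by (rule range_inj_infinite)
  next
    fix x assume x: "\<And>i. i < N \<Longrightarrow> x i \<in> G i"
    then have "\<forall>i\<in>{..<N}. \<exists>k::nat. x i = - of_nat k / b i" by (auto simp: G_def)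
    then obtain k :: "nat \<Rightarrow> nat" where k: "\<And>i. i < N \<Longrightarrow> x i = - of_nat (k i) / b i"
      by (metis lessThan_iff)
    have "(\<Sum>j<i. b j * x j) \<noteq> 1" if "i \<le> N" for i
    proof
      assume 1: "(\<Sum>j<i. b j * x j) = 1"
      have "(\<Sum>j<i. b j * x j) = (\<Sum>j<i. - of_nat (k j))"
        using that k nz by (intro sum.cong) (auto simp: b_def)
      also have "\<dots> = - of_nat (\<Sum>j<i. k j)" by (simp add: sum_negf)
      finally have 2: "1 = - (of_nat (\<Sum>j<i. k j) :: complex)" unfolding 1 .
      have "of_nat (Suc (\<Sum>j<i. k j)) = 1 + (of_nat (\<Sum>j<i. k j) :: complex)" by (rule of_nat_Suc)
      also have "\<dots> = 0" by (subst 2) (rule left_minus)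
      finally have "of_nat (Suc (\<Sum>j<i. k j)) = (0 :: complex)" .
      then show False by (simp only: of_nat_eq_0_iff)
    qed
    then have "\<exists>u. \<forall>i<N. split_point b N u i = x i"
      by (intro split_point_surj) (use nz in \<open>auto simp: b_def\<close>)
    then obtain u where "\<And>i. i < N \<Longrightarrow> split_point b N u i = x i" by blast
    then have "poly_eval (split_point b N u) R = poly_eval x R" by (rule poly_eval_cong[OF QR(2)])
    then show "poly_eval x R = 0" using zeroR[of u] by simp
  qed
  then show ?thesis using QR by auto
qed

text \<open>Split points with parameters in \<open>U\<close> are solutions in S-units, so a
  polynomial of degree below \<open>card U\<close> would vanish at every split point and be
  divisible by the hyperplane polynomial.\<close>

lemma admissible_imp_card_le_total_degree:
  assumes len: "length a = Suc N" and nz: "\<And>i. i < Suc N \<Longrightarrow> a ! i \<noteq> 0"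
    and aS: "\<And>i. i < Suc N \<Longrightarrow> S_unit S (a ! i)"
    and U: "finite U" "\<And>x. x \<in> U \<Longrightarrow> S_unit S x \<and> S_unit S (1 - x)"
    and P: "admissible a S P"
  shows "card U \<le> total_degree P"
proof (rule ccontr)
  assume "\<not> card U \<le> total_degree P"
  then have less: "total_degree P < card U" by simp
  define b where "b = (\<lambda>i. of_rat (a ! i) :: complex)"
  define V where "V = (of_rat ` U :: complex set)"
  have V: "finite V" "card V = card U"
    unfolding V_def using U(1) by (auto intro!: card_image inj_onI)
  have Pin: "P \<in> polys_in (Suc N)" using P len by (simp add: admissible_def)
  have "poly_eval (split_point b N u) P = 0" for u
  proof (rule separately_polynomial_zero_on_grid[where V = V and N = N and d = "total_degree P"
        and f = "\<lambda>u. poly_eval (split_point b N u) P"])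
    fix j u
    have "\<forall>i. \<exists>q. degree q \<le> 1 \<and> (\<forall>z. split_point b N (u(j := z)) i = poly q z)"
      by (intro allI split_point_affine)
    from choice[OF this] obtain q where
      q: "\<forall>i. degree (q i) \<le> 1 \<and> (\<forall>z. split_point b N (u(j := z)) i = poly (q i) z)"
      by (rule exE)
    then have deg: "degree (q i) \<le> 1" for i by simp
    have "split_point b N (u(j := z)) = (\<lambda>i. poly (q i) z)" for z
      by (rule ext) (simp add: q)
    then show "\<exists>p. degree p \<le> total_degree P \<and>
        (\<forall>z. poly_eval (split_point b N (u(j := z))) P = poly p z)"
      using poly_eval_of_affine[of q P, OF deg] by simp
  next
    show "finite V" "total_degree P < card V" using V less by auto
  next
    fix u assume "\<And>j. j < N \<Longrightarrow> u j \<in> V"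
    then have "\<forall>j. \<exists>r. j < N \<longrightarrow> r \<in> U \<and> u j = of_rat r" by (auto simp: V_def image_iff)
    from choice[OF this] obtain r where "\<forall>j. j < N \<longrightarrow> r j \<in> U \<and> u j = of_rat (r j)" by (rule exE)
    then have r: "r j \<in> U \<and> u j = of_rat (r j)" if "j < N" for j using that by simp
    \<comment> \<open>The solution is formed over the rationals, where S-units live, and only
      afterwards identified with the complex split point of \<open>u\<close>.\<close>
    define x where "x = map (split_point (\<lambda>i. a ! i) N r) [0..<Suc N]"
    have xi: "x ! i = split_point (\<lambda>i. a ! i) N r i" if "i < Suc N" for i
      unfolding x_def using that by (simp del: upt_Suc)
    have "S_unit S (x ! i)" if "i < Suc N" for i
    proof -
      have "S_unit S (if i < N then r i else 1)"
        using U(2) r S_unit_of_int[of 1 S] by auto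
      moreover have "S_unit S (\<Prod>j<i. 1 - r j)" using U(2) r that by (intro S_unit_prod) auto
      ultimately show ?thesis unfolding xi[OF that] split_point_def
        by (intro S_unit_divide S_unit_mult aS that)
    qed
    moreover have "(\<Sum>i<Suc N. a ! i * x ! i) = (\<Sum>i<Suc N. a ! i * split_point (\<lambda>i. a ! i) N r i)"
      using xi by (intro sum.cong) auto
    then have "(\<Sum>i<Suc N. a ! i * x ! i) = 1" using split_point_sum[of N "\<lambda>i. a ! i" r] nz by simp
    ultimately have "x \<in> unit_solutions a S" unfolding unit_solutions_def len by (simp add: x_def)
    then have "poly_eval (\<lambda>i. of_rat (x ! i)) P = 0" using P by (simp add: admissible_def)
    moreover have "of_rat (x ! i) = split_point b N u i" if "i < Suc N" for i
    proof -
      have "(\<Prod>j<i. 1 - u j) = (\<Prod>j<i. 1 - of_rat (r j))" using that r by (intro prod.cong) auto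
      then show ?thesis unfolding xi[OF that] split_point_def
        using r[of i] by (simp add: b_def of_rat_mult of_rat_divide of_rat_prod of_rat_diff)
    qed
    then have "poly_eval (\<lambda>i. of_rat (x ! i)) P = poly_eval (split_point b N u) P"
      by (rule poly_eval_cong[OF Pin])
    ultimately show "poly_eval (split_point b N u) P = 0" by simp
  qed
  then have "\<exists>Q \<in> polys_in (Suc N). P = hyperplane_poly a * Q"
    unfolding b_def by (intro poly_eval_split_point_zero_imp_dvd len nz Pin)
  then show False using P len by (simp add: admissible_def)
qed

section \<open>Effective computability\<close>

lemma recursive_const: "recursive k (\<lambda>xs. c)"
proof (induction c)
  case (Suc c)
  show ?case using recursive.comp[of "[\<lambda>xs. c]" "\<lambda>xs. Suc (hd xs)" k] recursive.succ Suc by simp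
qed (rule recursive.zero)

lemma recursive_Suc: "recursive k f \<Longrightarrow> recursive k (\<lambda>xs. Suc (f xs))"
  using recursive.comp[of "[f]" "\<lambda>xs. Suc (hd xs)" k] recursive.succ by simp

text \<open>Primitive recursion starting at \<open>c\<close> and adding \<open>m\<close> in each
  step; adding the fixed \<open>m\<close> is an \<open>m\<close>-fold successor.\<close>

lemma recursive_affine: "recursive 1 (\<lambda>xs. c + m * hd xs)"
proof -
  have "recursive 2 (\<lambda>xs. m + xs ! 1)"
  proof (induction m)
    case 0
    then show ?case using recursive.proj[of 1 2] by simp
  next
    case (Suc m)
    then show ?case using recursive_Suc by simp
  qed
  then have "recursive (Suc 0)
      (\<lambda>xs. rec_nat ((\<lambda>xs. c) (tl xs)) (\<lambda>y r. (\<lambda>xs. m + xs ! 1) (y # r # tl xs)) (hd xs))"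
    by (intro recursive.prim_rec recursive_const) (simp add: numeral_2_eq_2)
  moreover have "rec_nat c (\<lambda>y r. m + r) z = c + m * z" for z by (induction z) auto
  ultimately show ?thesis by simp
qed

lemma abs_le_int_encode: "nat \<bar>i\<bar> \<le> int_encode i"
  by (auto simp: int_encode_def sum_encode_def)

lemma member_le_list_encode: "x \<in> set xs \<Longrightarrow> x \<le> list_encode xs"
proof (induction xs)
  case (Cons y ys)
  have "y \<le> prod_encode (y, list_encode ys)" "list_encode ys \<le> prod_encode (y, list_encode ys)"
    by (rule le_prod_encode_1, rule le_prod_encode_2)
  then show ?case using Cons by auto
qed simp

text \<open>The encodings dominate their components, so the code bounds every prime occurring in a
  coefficient, and no factorisation has to be computed.\<close>

lemma prime_dvd_quotient_of_le_rat_encode: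
  assumes "r \<noteq> 0" "int p dvd fst (quotient_of r) \<or> int p dvd snd (quotient_of r)"
  shows "p \<le> rat_encode r"
proof -
  obtain m d where md: "quotient_of r = (m, d)" by force
  have d: "d > 0" using quotient_of_denom_pos[OF md] .
  have m: "m \<noteq> 0" using quotient_of_div[OF md] assms(1) by auto
  have enc: "rat_encode r = prod_encode (int_encode m, nat d)" by (simp add: rat_encode_def md)
  show ?thesis
  proof (cases "int p dvd d")
    case True
    then have "int p \<le> d" using d by (intro zdvd_imp_le)
    then have "p \<le> nat d" by simp
    then show ?thesis unfolding enc using le_prod_encode_2 le_trans by blast
  next
    case False
    then have "int p dvd m" using assms(2) md by simp
    then have "p \<le> nat \<bar>m\<bar>" using m dvd_imp_le_int[of m "int p"] by simp
    then show ?thesis unfolding enc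
      using abs_le_int_encode[of m] le_prod_encode_1 le_trans by blast
  qed
qed

section \<open>The lower bound for the least degree\<close>

theorem theorem2:
  "\<exists>s1 :: rat \<Rightarrow> rat list \<Rightarrow> nat. effectively_computable s1 \<and>
     (\<forall>(n::nat) (\<epsilon>::real) (a::rat list) (\<delta>::rat).
        n \<ge> 2 \<longrightarrow> \<epsilon> > 0 \<longrightarrow> length a = n \<longrightarrow> (\<forall>i<n. a ! i \<noteq> 0) \<longrightarrow>
        0 < \<delta> \<longrightarrow> of_rat \<delta> \<le> \<epsilon> \<longrightarrow>
        s1 \<delta> a > 0 \<and>
        (\<forall>s \<ge> s1 \<delta> a. \<exists>S::nat set. finite S \<and> (\<forall>p\<in>S. prime p) \<and> card S = s \<and>
           ereal_of_enat (min_vanishing_degree a S) \<ge>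
             ereal (exp ((4 - \<epsilon>) * real s powr (1/2) * ln (real s) powr (-1/2)))))"
proof -
  obtain C where C: "\<forall>s\<ge>C. \<forall>P0. finite P0 \<longrightarrow> (\<forall>p\<in>P0. prime p) \<longrightarrow> 4 * card P0 \<le> s \<longrightarrow>
    (\<exists>S U. finite S \<and> (\<forall>p\<in>S. prime p) \<and> P0 \<subseteq> S \<and> card S = s \<and>
      finite U \<and> (\<forall>x\<in>U. S_unit S x \<and> S_unit S (1 - x)) \<and>
      exp (4 * real s powr (1/2) * ln (real s) powr (-1/2)) \<le> real (card U))"
    using many_unit_solutions by (rule exE)
  define code where "code = (\<lambda>(d::rat) a. prod_encode (rat_encode d, list_encode (map rat_encode a)))"
  \<comment> \<open>The successor gives positivity, and the factor \<open>4\<close> yields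
    \<open>4 * card P0 \<le> s\<close>, since the primes in \<open>P0\<close> lie between
    \<open>1\<close> and the code.\<close>
  define s1 where "s1 = (\<lambda>d a. Suc C + 4 * code d a)"
  show ?thesis
  proof (intro exI[of _ s1] conjI allI impI)
    show "effectively_computable s1"
      unfolding effectively_computable_def s1_def code_def
      by (intro exI[of _ "\<lambda>xs. Suc C + 4 * hd xs"] conjI recursive_affine) simp
    fix n :: nat and \<epsilon> :: real and a :: "rat list" and \<delta> :: rat
    assume n: "n \<ge> 2" "\<epsilon> > 0" "length a = n" and nz: "\<forall>i<n. a ! i \<noteq> 0"
    show "s1 \<delta> a > 0" by (simp add: s1_def)
    fix s assume s: "s1 \<delta> a \<le> s"
    obtain N where N: "n = Suc N" using n by (cases n) auto
    \<comment> \<open>The primes that make the coefficients S-units, as the coordinates of a split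
      point are divided by them.\<close>
    define P0 where "P0 = {p::nat. prime p \<and> (\<exists>i<n. int p dvd fst (quotient_of (a ! i)) \<or>
      int p dvd snd (quotient_of (a ! i)))}"
    have "p \<in> {1..code \<delta> a}" if p: "p \<in> P0" for p
    proof -
      obtain i where i: "prime p" "i < n"
        "int p dvd fst (quotient_of (a ! i)) \<or> int p dvd snd (quotient_of (a ! i))"
        using p unfolding P0_def by blast
      have "p \<le> rat_encode (a ! i)"
        by (rule prime_dvd_quotient_of_le_rat_encode) (use i nz in auto)
      also have "\<dots> \<le> list_encode (map rat_encode a)"
        using i n by (intro member_le_list_encode) auto
      also have "\<dots> \<le> code \<delta> a" unfolding code_def by (rule le_prod_encode_2)
      finally show ?thesis using prime_ge_1_nat[OF i(1)] by simp
    qed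
    then have sub: "P0 \<subseteq> {1..code \<delta> a}" by blast
    have P0: "finite P0" "\<forall>p\<in>P0. prime p" using finite_subset[OF sub] by (simp_all add: P0_def)
    have "card P0 \<le> code \<delta> a" using card_mono[OF _ sub] by simp
    then have "4 * card P0 \<le> s" "C \<le> s" using s by (auto simp: s1_def)
    note C[rule_format, of s P0, OF this(2) P0(1) _ this(1)]
    then have "\<exists>S U. finite S \<and> (\<forall>p\<in>S. prime p) \<and> P0 \<subseteq> S \<and> card S = s \<and>
      finite U \<and> (\<forall>x\<in>U. S_unit S x \<and> S_unit S (1 - x)) \<and>
      exp (4 * real s powr (1/2) * ln (real s) powr (-1/2)) \<le> real (card U)"
      using P0(2) by simp
    then obtain S U where S: "finite S" "\<forall>p\<in>S. prime p" "P0 \<subseteq> S" "card S = s"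
      and U: "finite U" "\<forall>x\<in>U. S_unit S x \<and> S_unit S (1 - x)"
      and cU: "exp (4 * real s powr (1/2) * ln (real s) powr (-1/2)) \<le> real (card U)" by (elim exE conjE)
    have aS: "S_unit S (a ! i)" if "i < Suc N" for i
      unfolding S_unit_def using that nz S(3) unfolding N P0_def by blast
    \<comment> \<open>Bounding every admissible degree also covers the case of no admissible
      polynomial, where the infimum is infinite.\<close>
    have "enat (card U) \<le> min_vanishing_degree a S"
      unfolding min_vanishing_degree_def
    proof (rule INF_greatest)
      fix P assume "P \<in> {P. admissible a S P}"
      then have "card U \<le> total_degree P"
        using admissible_imp_card_le_total_degree[of a N S U P] n N nz aS U by auto
      then show "enat (card U) \<le> enat (total_degree P)" by simp
    qed
    then have "ereal_of_enat (enat (card U)) \<le> ereal_of_enat (min_vanishing_degree a S)"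
      by (simp only: ereal_of_enat_le_iff)
    then have 1: "ereal (real (card U)) \<le> ereal_of_enat (min_vanishing_degree a S)" by simp
    \<comment> \<open>The solutions were counted with the constant \<open>4\<close>, and
      \<open>4 - \<epsilon> \<le> 4\<close>.\<close>
    have "(4 - \<epsilon>) * real s powr (1/2) * ln (real s) powr (-1/2) \<le>
        4 * real s powr (1/2) * ln (real s) powr (-1/2)"
      using n by (intro mult_right_mono) auto
    then have "exp ((4 - \<epsilon>) * real s powr (1/2) * ln (real s) powr (-1/2)) \<le> real (card U)"
      using cU by (meson exp_le_cancel_iff order_trans)
    then have "ereal (exp ((4 - \<epsilon>) * real s powr (1/2) * ln (real s) powr (-1/2))) \<le>
        ereal_of_enat (min_vanishing_degree a S)"
      using 1 by (meson ereal_less_eq(3) order_trans)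
    then show "\<exists>S::nat set. finite S \<and> (\<forall>p\<in>S. prime p) \<and> card S = s \<and>
           ereal_of_enat (min_vanishing_degree a S) \<ge>
             ereal (exp ((4 - \<epsilon>) * real s powr (1/2) * ln (real s) powr (-1/2)))"
      using S by blast
  qed
qed

end
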